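(* Let $B_t$ be a $d$-dimensional Brownian motion and $Q_t$ a stochastic process with values in $\mathcal L(\mathbb R^d,E)$, where $E$ is a Banach space. Assume that the Itô stochastic integral $I_t=\int_r^tQ_s\,dB_s$, $r\in(0,T)$, exists in $E$, and define $R_{s,t}=\delta I_{s,t}-Q_s\,\delta B_{s,t}$. Assume further that there exist $q>2$, $\beta\in(\frac1q,\frac12]$ and a constant $C>0$ such that for all $s,t\in[r,T]$, $$\mathbb E\|\delta Q_{s,t}\|^q\le C|t-s|^{q\beta}\quad\text{and}\quad\mathbb E\|R_{s,t}\|_E^{q/2}\le C|t-s|^{q\beta}.$$ Then, for all $\alpha\in(0,\beta-q^{-1})$, there exist a version of $R_{s,t}$ and a positive random variable $k_\alpha$ such that $\mathbb E|k_\alpha|^{q/2}<\infty$ and, for all $s,t\in[r,T]$, $$\|R_{s,t}\|_E\le k_\alpha|t-s|^{2\alpha}\quad\text{a.s.}$$ If, moreover, $\beta-q^{-1}>\frac13$, then, for $\alpha\in(\frac13,\beta-q^{-1})$, there exist $\alpha$-Hölder continuous versions of $Q_t$ and $I_t$ such that $I_t$ is controlled by $B_t$ and $I'_t=Q_t$ a.s.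
   Context: For a path $U$, $\delta U_{s,t}=U_t-U_s$. $\|\delta Q_{s,t}\|$ is the norm in $\mathcal L(\mathbb R^d,E)$. $I$ is controlled by $B$ with Gubinelli derivative $I'$ on $[r,T]$ if (for the given sample path) $I\in C^\alpha([r,T],E)$, $I'\in C^\alpha([r,T],\mathcal L(\mathbb R^d,E))$ (spaces of $\alpha$-Hölder continuous paths), and the remainder $R^I_{s,t}=\delta I_{s,t}-I'_s\,\delta B_{s,t}$ satisfies $\sup_{s\ne t\in[r,T]}\|R^I_{s,t}\|_E/|t-s|^{2\alpha}<\infty$. *)

theory Defs
  imports "HOL-Probability.Probability"
begin

text \<open>
  The Banach space E is not assumed separable, so random variables with values in E or in
  L(R^d, E) are taken to be strongly measurable; plain Borel measurability would not be
  stable under sums.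
\<close>

definition strongly_measurable :: "'w measure \<Rightarrow> ('w \<Rightarrow> 'b::real_normed_vector) \<Rightarrow> bool" where
  "strongly_measurable M X \<longleftrightarrow>
     (\<exists>S. (\<forall>n::nat. simple_function M (S n)) \<and> (\<forall>\<omega>\<in>space M. (\<lambda>n. S n \<omega>) \<longlonglongrightarrow> X \<omega>))"

definition is_version ::
  "'w measure \<Rightarrow> 'i set \<Rightarrow> ('i \<Rightarrow> 'w \<Rightarrow> 'b::real_normed_vector) \<Rightarrow> ('i \<Rightarrow> 'w \<Rightarrow> 'b) \<Rightarrow> bool" where
  "is_version M J X Y \<longleftrightarrow>
     (\<forall>i\<in>J. strongly_measurable M (Y i) \<and> (AE \<omega> in M. Y i \<omega> = X i \<omega>))"

text \<open>
  Standard d-dimensional Brownian motion on [0, \<infinity>) relative to a filtration F. The density of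
  an increment is that of the centred Gaussian law with covariance (t - s) times the identity.
\<close>

definition brownian_motion ::
  "'w measure \<Rightarrow> (real \<Rightarrow> 'w measure) \<Rightarrow> (real \<Rightarrow> 'w \<Rightarrow> real ^ 'd) \<Rightarrow> bool" where
  "brownian_motion M F B \<longleftrightarrow>
     prob_space M \<and> filtration (space M) F \<and> (\<forall>t. subalgebra M (F t)) \<and>
     (\<forall>t\<ge>0. B t \<in> borel_measurable (F t)) \<and>
     (AE \<omega> in M. B 0 \<omega> = 0) \<and>
     (\<forall>s t. 0 \<le> s \<and> s < t \<longrightarrow>
        distributed M lborel (\<lambda>\<omega>. B t \<omega> - B s \<omega>)
          (\<lambda>x. ennreal (\<Prod>i\<in>UNIV. normal_density 0 (sqrt (t - s)) (x $ i))) \<and>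
        prob_space.indep_set M (sets (F s))
          {(\<lambda>\<omega>. B t \<omega> - B s \<omega>) -` A \<inter> space M | A. A \<in> sets borel}) \<and>
     (AE \<omega> in M. continuous_on {0..} (\<lambda>t. B t \<omega>))"

text \<open>
  Elementary adapted integrands on [r, t]: bounded, constant on each \<open>(\<tau> i, \<tau> (Suc i)]\<close>, with
  values in the row vectors L(R^d, R).
\<close>

definition elementary_integrand ::
  "(real \<Rightarrow> 'w measure) \<Rightarrow> real \<Rightarrow> real \<Rightarrow> nat \<Rightarrow> (nat \<Rightarrow> real) \<Rightarrow>
   (nat \<Rightarrow> 'w \<Rightarrow> (real ^ 'd) \<Rightarrow>\<^sub>L real) \<Rightarrow> bool" where
  "elementary_integrand F r t n \<tau> \<xi> \<longleftrightarrow>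
     \<tau> 0 = r \<and> \<tau> n = t \<and> (\<forall>i<n. \<tau> i \<le> \<tau> (Suc i)) \<and>
     (\<forall>i<n. \<xi> i \<in> borel_measurable (F (\<tau> i)) \<and> bounded (\<xi> i ` space (F (\<tau> i))))"

definition elementary_process ::
  "nat \<Rightarrow> (nat \<Rightarrow> real) \<Rightarrow> (nat \<Rightarrow> 'w \<Rightarrow> (real ^ 'd) \<Rightarrow>\<^sub>L real) \<Rightarrow>
   real \<Rightarrow> 'w \<Rightarrow> (real ^ 'd) \<Rightarrow>\<^sub>L real" where
  "elementary_process n \<tau> \<xi> s \<omega> = (\<Sum>i<n. indicator {\<tau> i<..\<tau> (Suc i)} s *\<^sub>R \<xi> i \<omega>)"

definition elementary_integral ::
  "(real \<Rightarrow> 'w \<Rightarrow> real ^ 'd) \<Rightarrow> nat \<Rightarrow> (nat \<Rightarrow> real) \<Rightarrow>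
   (nat \<Rightarrow> 'w \<Rightarrow> (real ^ 'd) \<Rightarrow>\<^sub>L real) \<Rightarrow> 'w \<Rightarrow> real" where
  "elementary_integral B n \<tau> \<xi> \<omega> =
     (\<Sum>i<n. blinfun_apply (\<xi> i \<omega>) (B (\<tau> (Suc i)) \<omega> - B (\<tau> i) \<omega>))"

text \<open>
  \<open>X\<close> is (a version of) the scalar Ito integral of \<open>H\<close> over [r, t]: \<open>H\<close> is measurable, adapted and
  almost surely square integrable in time, and \<open>X\<close> is the limit in probability of the
  integrals of elementary integrands which approximate \<open>H\<close> in L^2([r, t]) in probability. This
  determines \<open>X\<close> up to null sets.
\<close>

definition is_scalar_ito_integral ::
  "'w measure \<Rightarrow> (real \<Rightarrow> 'w measure) \<Rightarrow> (real \<Rightarrow> 'w \<Rightarrow> real ^ 'd) \<Rightarrow> real \<Rightarrow> real \<Rightarrow>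
   (real \<Rightarrow> 'w \<Rightarrow> (real ^ 'd) \<Rightarrow>\<^sub>L real) \<Rightarrow> ('w \<Rightarrow> real) \<Rightarrow> bool" where
  "is_scalar_ito_integral M F B r t H X \<longleftrightarrow>
     (\<lambda>(s, \<omega>). H s \<omega>) \<in> borel_measurable (restrict_space borel {r..t} \<Otimes>\<^sub>M M) \<and>
     (\<forall>s\<in>{r..t}. H s \<in> borel_measurable (F s)) \<and>
     (AE \<omega> in M. (\<integral>\<^sup>+ s\<in>{r..t}. ennreal ((norm (H s \<omega>))\<^sup>2) \<partial>lborel) < \<infinity>) \<and>
     X \<in> borel_measurable M \<and>
     (\<exists>n \<tau> \<xi>.
        (\<forall>k::nat. elementary_integrand F r t (n k) (\<tau> k) (\<xi> k)) \<and>
        (\<forall>\<epsilon>>0. (\<lambda>k. measure M {\<omega> \<in> space M.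
            (\<integral>\<^sup>+ s\<in>{r..t}. ennreal ((norm (elementary_process (n k) (\<tau> k) (\<xi> k) s \<omega> - H s \<omega>))\<^sup>2)
               \<partial>lborel) > ennreal \<epsilon>}) \<longlonglongrightarrow> 0) \<and>
        (\<forall>\<epsilon>>0. (\<lambda>k. measure M {\<omega> \<in> space M.
            \<bar>elementary_integral B (n k) (\<tau> k) (\<xi> k) \<omega> - X \<omega>\<bar> > \<epsilon>}) \<longlonglongrightarrow> 0))"

text \<open>
  The Ito integral of an L(R^d, E)-valued process exists in E with value \<open>X\<close> if \<open>X\<close> is an
  E-valued random variable which every continuous functional \<open>\<phi>\<close> maps to the scalar Ito
  integral of \<open>\<phi> \<circ> Q\<close>. No geometric property of E (Hilbert, type 2, UMD) is needed
  for this notion, and the strong constructions available in such spaces satisfy it.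
\<close>

definition is_ito_integral ::
  "'w measure \<Rightarrow> (real \<Rightarrow> 'w measure) \<Rightarrow> (real \<Rightarrow> 'w \<Rightarrow> real ^ 'd) \<Rightarrow> real \<Rightarrow> real \<Rightarrow>
   (real \<Rightarrow> 'w \<Rightarrow> (real ^ 'd) \<Rightarrow>\<^sub>L 'e::banach) \<Rightarrow> ('w \<Rightarrow> 'e) \<Rightarrow> bool" where
  "is_ito_integral M F B r t Q X \<longleftrightarrow>
     strongly_measurable M X \<and>
     (\<forall>\<phi>::'e \<Rightarrow>\<^sub>L real. is_scalar_ito_integral M F B r t
        (\<lambda>s \<omega>. \<phi> o\<^sub>L Q s \<omega>) (\<lambda>\<omega>. blinfun_apply \<phi> (X \<omega>)))"

definition holder_on :: "real \<Rightarrow> real set \<Rightarrow> (real \<Rightarrow> 'b::real_normed_vector) \<Rightarrow> bool" where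
  "holder_on \<alpha> J x \<longleftrightarrow> (\<exists>C. \<forall>s\<in>J. \<forall>t\<in>J. norm (x t - x s) \<le> C * \<bar>t - s\<bar> powr \<alpha>)"

text \<open>The arguments are single paths: driver \<open>b\<close>, path \<open>x\<close>, Gubinelli derivative \<open>x'\<close>.\<close>

definition remainder ::
  "(real \<Rightarrow> real ^ 'd) \<Rightarrow> (real \<Rightarrow> 'e::banach) \<Rightarrow> (real \<Rightarrow> (real ^ 'd) \<Rightarrow>\<^sub>L 'e) \<Rightarrow>
   real \<Rightarrow> real \<Rightarrow> 'e" where
  "remainder b x x' s t = (x t - x s) - blinfun_apply (x' s) (b t - b s)"

definition controlled_by ::
  "real \<Rightarrow> real set \<Rightarrow> (real \<Rightarrow> real ^ 'd) \<Rightarrow> (real \<Rightarrow> 'e::banach) \<Rightarrow>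
   (real \<Rightarrow> (real ^ 'd) \<Rightarrow>\<^sub>L 'e) \<Rightarrow> bool" where
  "controlled_by \<alpha> J b x x' \<longleftrightarrow>
     holder_on \<alpha> J x \<and> holder_on \<alpha> J x' \<and>
     bdd_above {norm (remainder b x x' s t) / \<bar>t - s\<bar> powr (2 * \<alpha>) | s t. s \<in> J \<and> t \<in> J \<and> s \<noteq> t}"

end

theory Submission
  imports Defs
begin

text \<open>
  The proof is a Kolmogorov continuity argument for the pair \<open>(Q, R)\<close>.  The remainder is not an
  increment of a path, but satisfies Chen's relation
  \<open>R s t = R s u + R u t + (Q u - Q s) (B t - B u)\<close> (\<open>remainder_chen\<close>), in which the last term is a
  product of two increments.

  Let \<open>\<theta> = 2 powr -\<alpha>\<close>.  The random variable \<open>A\<close> is the sum, over all levels \<open>n\<close> and all pairs of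
  neighbouring points of the dyadic partition of level \<open>n\<close> of \<open>[r, T]\<close>, of \<open>2 powr (n * q * \<alpha>)\<close>
  times the \<open>q\<close>-th powers of the increments of \<open>Q\<close> and \<open>B\<close> and the \<open>q/2\<close>-th power of \<open>R\<close>.  The
  moment hypotheses, the Gaussian estimate \<open>E |B t - B s| ^ q \<le> c * |t - s| powr (q / 2)\<close>
  (\<open>brownian_increment_moment\<close>) and \<open>\<alpha> < \<beta> - 1/q\<close>, \<open>\<beta> \<le> 1/2\<close> make its expectation a convergent
  geometric series (\<open>nn_integral_dyadic_sum_finite\<close>).  With \<open>K = A powr (1/q)\<close>, almost surely every
  such increment of level \<open>n\<close> of \<open>Q\<close> and \<open>B\<close> is at most \<open>K * \<theta> ^ n\<close> and every such \<open>R\<close> is at most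
  \<open>(K * \<theta> ^ n)\<^sup>2\<close>.

  The rest is deterministic.  Replace \<open>s\<close> and \<open>t\<close> by the last dyadic points \<open>s_n\<close> and \<open>t_n\<close> of level \<open>n\<close>
  before them, starting at the level \<open>m\<close> at which \<open>s_m\<close> and \<open>t_m\<close> coincide or are neighbours.  Passing
  from level \<open>n\<close> to \<open>n + 1\<close> moves each point by at most one dyadic step, so the increments of \<open>Q\<close>
  and \<open>B\<close> over \<open>[s_n, t_n]\<close> change by at most \<open>2 * K * \<theta> ^ (n + 1)\<close> (\<open>increment_chain\<close>), and Chen's
  relation shows that the remainder changes by at most a constant times
  \<open>K\<^sup>2 * \<theta> ^ m * \<theta> ^ n\<close> (\<open>remainder_chain\<close>).  Summing over \<open>n \<ge> m\<close> gives Hoelder bounds of order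
  \<open>\<alpha>\<close> for \<open>Q\<close> and \<open>B\<close> and of order \<open>2 * \<alpha>\<close>, with constant a multiple of \<open>K\<^sup>2\<close>, for the remainder of the
  limits along \<open>s_n\<close> and \<open>t_n\<close>.  Since \<open>(K\<^sup>2) powr (q/2) = A\<close>, this constant has a finite moment of
  order \<open>q/2\<close>.

  The limits \<open>Q'\<close> and \<open>I'\<close> along the dyadic approximations, set to zero on a null set, are the required
  versions: the moment bounds at the approximations of a fixed \<open>t\<close> are summable, which
  identifies the limits with \<open>Q t\<close> and \<open>I t\<close> almost surely.  All assertions then hold for the
  remainder of \<open>I'\<close> and \<open>Q'\<close> (\<open>controlled_versions_exist\<close>), for every \<open>\<alpha>\<close> in \<open>(0, \<beta> - 1/q)\<close>.
\<close>

section \<open>Strong measurability\<close>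

text \<open>
  Strong measurability means Borel measurability together with a separable range.  In this form it
  is visibly stable under pointwise limits.
\<close>

lemma strongly_measurable_iff:
  fixes X :: "'w \<Rightarrow> 'b::real_normed_vector"
  shows "strongly_measurable M X \<longleftrightarrow>
    X \<in> borel_measurable M \<and> (\<exists>D. countable D \<and> X ` space M \<subseteq> closure D)"
proof
  assume "strongly_measurable M X"
  then obtain S where S: "\<And>n::nat. simple_function M (S n)"
    "\<And>\<omega>. \<omega> \<in> space M \<Longrightarrow> (\<lambda>n. S n \<omega>) \<longlonglongrightarrow> X \<omega>"
    unfolding strongly_measurable_def by auto
  have "X \<in> borel_measurable M"
    using S by (intro borel_measurable_LIMSEQ_metric[of S M X] borel_measurable_simple_function) auto
  moreover have "countable (\<Union>n. S n ` space M)"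
    using S(1) by (intro countable_UN) (auto simp: simple_function_def countable_finite)
  moreover have "X \<omega> \<in> closure (\<Union>n. S n ` space M)" if "\<omega> \<in> space M" for \<omega>
  proof (rule closure_sequential[THEN iffD2], intro exI conjI allI)
    show "S n \<omega> \<in> (\<Union>n. S n ` space M)" for n using that by blast
    show "(\<lambda>n. S n \<omega>) \<longlonglongrightarrow> X \<omega>" by (rule S(2)[OF that])
  qed
  ultimately show "X \<in> borel_measurable M \<and> (\<exists>D. countable D \<and> X ` space M \<subseteq> closure D)"
    by blast
next
  assume "X \<in> borel_measurable M \<and> (\<exists>D. countable D \<and> X ` space M \<subseteq> closure D)"
  then obtain D where X [measurable]: "X \<in> borel_measurable M"
    and D: "countable D" "X ` space M \<subseteq> closure D" by auto
  define d where "d = from_nat_into (insert 0 D)"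
  have d_range: "range d = insert 0 D"
    unfolding d_def using D(1) by (intro range_from_nat_into) auto
  \<comment> \<open>the n-th approximation takes the first of \<open>d 0, \<dots>, d n\<close> that is closest to the value of \<open>X\<close>\<close>
  define J where "J n \<omega> = (LEAST j. j \<le> n \<and> (\<forall>i\<le>n. dist (X \<omega>) (d j) \<le> dist (X \<omega>) (d i)))" for n \<omega>
  have J: "J n \<omega> \<le> n \<and> (\<forall>i\<le>n. dist (X \<omega>) (d (J n \<omega>)) \<le> dist (X \<omega>) (d i))" for n \<omega>
  proof -
    have "\<exists>j. j \<le> n \<and> (\<forall>i\<le>n. dist (X \<omega>) (d j) \<le> dist (X \<omega>) (d i))"
      using ex_min_if_finite[of "(\<lambda>i. dist (X \<omega>) (d i)) ` {..n}"]
      by (force simp: not_less)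
    then show ?thesis unfolding J_def by (rule LeastI_ex)
  qed
  have [measurable]: "(\<lambda>\<omega>. dist (X \<omega>) (d i)) \<in> borel_measurable M" for i
    by (rule measurable_compose[OF X borel_measurable_continuous_onI]) (intro continuous_intros)
  have J_meas: "J n \<in> measurable M (count_space UNIV)" for n
    unfolding J_def by measurable
  have "simple_function M (J n)" for n
    unfolding simple_function_def
  proof (intro conjI ballI)
    have "J n ` space M \<subseteq> {..n}" using J[of n] by blast
    then show "finite (J n ` space M)" by (rule finite_subset) simp
    show "J n -` {j} \<inter> space M \<in> sets M" for j
      by (rule measurable_sets[OF J_meas]) simp
  qed
  then have "simple_function M (\<lambda>\<omega>. d (J n \<omega>))" for n by (rule simple_function_compose1)
  moreover have "(\<lambda>n. d (J n \<omega>)) \<longlonglongrightarrow> X \<omega>" if "\<omega> \<in> space M" for \<omega>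
  proof (rule LIMSEQ_I)
    fix e :: real assume "0 < e"
    moreover have "X \<omega> \<in> closure D" using D(2) that by auto
    ultimately obtain y where "y \<in> D" "dist y (X \<omega>) < e"
      using closure_approachable by blast
    moreover then obtain i where "y = d i" using d_range by (metis insertCI rangeE)
    ultimately have "dist (X \<omega>) (d i) < e" by (simp add: dist_commute)
    then have "norm (d (J n \<omega>) - X \<omega>) < e" if "n \<ge> i" for n
      using J[of n \<omega>] that by (metis dist_commute dist_norm order_le_less_trans)
    then show "\<exists>N. \<forall>n\<ge>N. norm (d (J n \<omega>) - X \<omega>) < e" by blast
  qed
  ultimately show "strongly_measurable M X"
    unfolding strongly_measurable_def by (intro exI[of _ "\<lambda>n \<omega>. d (J n \<omega>)"]) simp
qed

lemma strongly_measurable_imp_borel_measurable: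
  "strongly_measurable M X \<Longrightarrow> X \<in> borel_measurable M"
  by (simp add: strongly_measurable_iff)

lemma borel_measurable_imp_strongly_measurable:
  fixes X :: "'w \<Rightarrow> 'b::{real_normed_vector, second_countable_topology}"
  assumes "X \<in> borel_measurable M"
  shows "strongly_measurable M X"
proof -
  obtain D :: "'b set" where "countable D" "\<And>U. open U \<Longrightarrow> U \<noteq> {} \<Longrightarrow> \<exists>d\<in>D. d \<in> U"
    using countable_dense_setE by blast
  then have "closure D = UNIV"
    by (metis Compl_disjoint Compl_empty_eq Int_iff closed_closure closure_subset
        disjoint_iff double_complement open_Compl subsetD)
  with \<open>countable D\<close> assms show ?thesis by (auto simp: strongly_measurable_iff)
qed

lemma borel_measurable_norm_of_strongly_measurable:
  "strongly_measurable M X \<Longrightarrow> (\<lambda>\<omega>. norm (X \<omega>)) \<in> borel_measurable M"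
  by (rule measurable_compose[OF strongly_measurable_imp_borel_measurable borel_measurable_norm])

lemma strongly_measurable_LIMSEQ:
  fixes X :: "nat \<Rightarrow> 'w \<Rightarrow> 'b::real_normed_vector"
  assumes "\<And>n. strongly_measurable M (X n)"
    and lim: "\<And>\<omega>. \<omega> \<in> space M \<Longrightarrow> (\<lambda>n. X n \<omega>) \<longlonglongrightarrow> Y \<omega>"
  shows "strongly_measurable M Y"
proof -
  obtain D where X: "\<And>n. X n \<in> borel_measurable M"
    and D: "\<And>n. countable (D n) \<and> X n ` space M \<subseteq> closure (D n)"
    using assms(1) unfolding strongly_measurable_iff by metis
  have "Y \<omega> \<in> closure (\<Union>n. D n)" if "\<omega> \<in> space M" for \<omega>
  proof (rule Lim_in_closed_set[OF _ _ _ lim[OF that]])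
    show "\<forall>\<^sub>F n in sequentially. X n \<omega> \<in> closure (\<Union>n. D n)"
    proof (intro always_eventually allI)
      fix n
      have "X n \<omega> \<in> closure (D n)" using D[of n] that by auto
      then show "X n \<omega> \<in> closure (\<Union>n. D n)"
        using closure_mono[of "D n" "\<Union>n. D n"] by auto
    qed
  qed auto
  then have "Y ` space M \<subseteq> closure (\<Union>n. D n)" by blast
  moreover have "countable (\<Union>n. D n)" using D by blast
  ultimately show ?thesis
    using borel_measurable_LIMSEQ_metric[OF X lim] unfolding strongly_measurable_iff by blast
qed

lemma strongly_measurable_continuous2:
  assumes X: "strongly_measurable M X" and Y: "strongly_measurable M Y"
    and f: "\<And>x y a b. x \<longlonglongrightarrow> a \<Longrightarrow> y \<longlonglongrightarrow> b \<Longrightarrow> (\<lambda>n::nat. f (x n) (y n)) \<longlonglongrightarrow> f a b"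
  shows "strongly_measurable M (\<lambda>\<omega>. f (X \<omega>) (Y \<omega>))"
proof -
  obtain S S' where "\<And>n::nat. simple_function M (S n)" "\<And>n::nat. simple_function M (S' n)"
    "\<And>\<omega>. \<omega> \<in> space M \<Longrightarrow> (\<lambda>n. S n \<omega>) \<longlonglongrightarrow> X \<omega>"
    "\<And>\<omega>. \<omega> \<in> space M \<Longrightarrow> (\<lambda>n. S' n \<omega>) \<longlonglongrightarrow> Y \<omega>"
    using X Y unfolding strongly_measurable_def by metis
  then show ?thesis
    unfolding strongly_measurable_def
    by (intro exI[of _ "\<lambda>n \<omega>. f (S n \<omega>) (S' n \<omega>)"]) (auto intro: simple_function_compose2 f)
qed

lemma strongly_measurable_diff:
  "strongly_measurable M X \<Longrightarrow> strongly_measurable M Y \<Longrightarrow> strongly_measurable M (\<lambda>\<omega>. X \<omega> - Y \<omega>)"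
  by (rule strongly_measurable_continuous2) (auto intro: tendsto_intros)

lemma strongly_measurable_blinfun_apply:
  "strongly_measurable M X \<Longrightarrow> strongly_measurable M Y \<Longrightarrow>
    strongly_measurable M (\<lambda>\<omega>. blinfun_apply (X \<omega>) (Y \<omega>))"
  by (rule strongly_measurable_continuous2) (auto intro: tendsto_intros)

lemma strongly_measurable_restrict:
  assumes "strongly_measurable M X" "G \<in> sets M"
  shows "strongly_measurable M (\<lambda>\<omega>. indicat_real G \<omega> *\<^sub>R X \<omega>)"
  by (rule strongly_measurable_continuous2[OF borel_measurable_imp_strongly_measurable assms(1)])
     (use assms(2) in \<open>auto intro: tendsto_intros\<close>)

lemma strongly_measurable_remainder:
  assumes "strongly_measurable M (b s)" "strongly_measurable M (b t)"
    "strongly_measurable M (x s)" "strongly_measurable M (x t)" "strongly_measurable M (x' s)"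
  shows "strongly_measurable M (\<lambda>\<omega>. remainder (\<lambda>u. b u \<omega>) (\<lambda>u. x u \<omega>) (\<lambda>u. x' u \<omega>) s t)"
  unfolding remainder_def
  by (intro strongly_measurable_diff strongly_measurable_blinfun_apply assms)

lemma brownian_motion_strongly_measurable:
  assumes "brownian_motion M F B" "0 \<le> t"
  shows "strongly_measurable M (B t)"
proof (rule borel_measurable_imp_strongly_measurable)
  have "B t \<in> borel_measurable (F t)" "subalgebra M (F t)"
    using assms by (auto simp: brownian_motion_def)
  then show "B t \<in> borel_measurable M" using measurable_from_subalg by blast
qed

section \<open>Moments of Gaussian increments\<close>

lemma nn_integral_std_normal_moment_finite:
  "(\<integral>\<^sup>+y. ennreal (std_normal_density y * (1 + \<bar>y\<bar>) powr q) \<partial>lborel) < \<infinity>"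
proof -
  define n where "n = nat \<lceil>q\<rceil>"
  have le: "(1 + \<bar>y\<bar>) powr q \<le> 2 ^ n * (1 + \<bar>y\<bar> ^ n)" for y :: real
  proof -
    have "(1 + \<bar>y\<bar>) powr q \<le> (1 + \<bar>y\<bar>) powr real n"
      unfolding n_def by (intro powr_mono) (auto simp: real_nat_ceiling_ge)
    also have "\<dots> = (1 + \<bar>y\<bar>) ^ n" by (simp add: powr_realpow add_pos_nonneg)
    also have "\<dots> \<le> (2 * max 1 \<bar>y\<bar>) ^ n" by (intro power_mono) auto
    also have "\<dots> \<le> 2 ^ n * (1 + \<bar>y\<bar> ^ n)"
      by (auto simp: power_mult_distrib max_def)
    finally show ?thesis .
  qed
  have "integrable lborel (\<lambda>y. 2 ^ n * (std_normal_density y * \<bar>y\<bar> ^ 0 + std_normal_density y * \<bar>y\<bar> ^ n))"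
    by (intro integrable_mult_right Bochner_Integration.integrable_add integrable_std_normal_moment_abs)
  then have "(\<integral>\<^sup>+y. ennreal (2 ^ n * (std_normal_density y * \<bar>y\<bar> ^ 0 + std_normal_density y * \<bar>y\<bar> ^ n)) \<partial>lborel) < \<infinity>"
    by (subst nn_integral_eq_integral) auto
  moreover have "(\<integral>\<^sup>+y. ennreal (std_normal_density y * (1 + \<bar>y\<bar>) powr q) \<partial>lborel) \<le>
    (\<integral>\<^sup>+y. ennreal (2 ^ n * (std_normal_density y * \<bar>y\<bar> ^ 0 + std_normal_density y * \<bar>y\<bar> ^ n)) \<partial>lborel)"
  proof (intro nn_integral_mono ennreal_leI)
    fix y :: real
    show "std_normal_density y * (1 + \<bar>y\<bar>) powr q
        \<le> 2 ^ n * (std_normal_density y * \<bar>y\<bar> ^ 0 + std_normal_density y * \<bar>y\<bar> ^ n)"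
      using mult_left_mono[OF le[of y], of "std_normal_density y"] by (simp add: algebra_simps)
  qed
  ultimately show ?thesis by (rule le_less_trans[rotated])
qed

lemma nn_integral_normal_scale:
  assumes "\<sigma> > 0"
  shows "(\<integral>\<^sup>+x. ennreal (normal_density 0 \<sigma> x * (1 + \<bar>x\<bar> / \<sigma>) powr q) \<partial>lborel) =
         (\<integral>\<^sup>+y. ennreal (std_normal_density y * (1 + \<bar>y\<bar>) powr q) \<partial>lborel)"
proof -
  have "\<sigma> * normal_density 0 \<sigma> (\<sigma> * y) = std_normal_density y" for y
    using assms by (simp add: normal_density_def real_sqrt_mult power_mult_distrib)
  then have "ennreal \<sigma> * ennreal (normal_density 0 \<sigma> (\<sigma> * y) * (1 + \<bar>\<sigma> * y\<bar> / \<sigma>) powr q)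
      = ennreal (std_normal_density y * (1 + \<bar>y\<bar>) powr q)" for y
    using assms by (simp add: ennreal_mult[symmetric] abs_mult mult.assoc[symmetric])
  then show ?thesis
    using assms by (subst nn_integral_real_affine[of _ \<sigma> 0])
      (auto simp: nn_integral_cmult[symmetric] simp del: ennreal_mult')
qed

text \<open>
  A bound for the norm that factorises over the coordinates, so that its Gaussian moments are
  products of one-dimensional integrals.
\<close>

lemma norm_le_prod_coordinates:
  fixes x :: "real ^ 'd"
  assumes "\<sigma> > 0"
  shows "norm x \<le> \<sigma> * (\<Prod>i\<in>UNIV. (1 + \<bar>x $ i\<bar> / \<sigma>))"
proof -
  have "1 + (\<Sum>i\<in>A. \<bar>x $ i\<bar> / \<sigma>) \<le> (\<Prod>i\<in>A. (1 + \<bar>x $ i\<bar> / \<sigma>))" if "finite A" for A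
    using that
  proof (induction A rule: finite_induct)
    case (insert a A)
    have "1 \<le> (\<Prod>i\<in>A. (1 + \<bar>x $ i\<bar> / \<sigma>))"
      using assms by (intro prod_ge_1) auto
    then have "\<bar>x $ a\<bar> / \<sigma> \<le> \<bar>x $ a\<bar> / \<sigma> * (\<Prod>i\<in>A. (1 + \<bar>x $ i\<bar> / \<sigma>))"
      using assms mult_left_mono[of 1 _ "\<bar>x $ a\<bar> / \<sigma>"] by fastforce
    with insert show ?case by (simp add: algebra_simps)
  qed simp
  from this[of UNIV] have "\<sigma> * (\<Sum>i\<in>UNIV. \<bar>x $ i\<bar> / \<sigma>) \<le> \<sigma> * (\<Prod>i\<in>UNIV. (1 + \<bar>x $ i\<bar> / \<sigma>))"
    using assms by (intro mult_left_mono) auto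
  moreover have "\<sigma> * (\<Sum>i\<in>UNIV. \<bar>x $ i\<bar> / \<sigma>) = (\<Sum>i\<in>UNIV. \<bar>x $ i\<bar>)"
    using assms by (simp add: sum_distrib_left)
  ultimately show ?thesis using norm_le_l1_cart[of x] by linarith
qed

lemma gaussian_norm_moment:
  assumes "q \<ge> 0"
  obtains K where "K \<ge> 0"
    "\<And>\<sigma>. \<sigma> > 0 \<Longrightarrow> (\<integral>\<^sup>+x. ennreal (\<Prod>i\<in>UNIV. normal_density 0 \<sigma> (x $ i)) *
       ennreal (norm (x :: real ^ 'd) powr q) \<partial>lborel) \<le> ennreal (K * \<sigma> powr q)"
proof
  define J where "J = enn2real (\<integral>\<^sup>+y. ennreal (std_normal_density y * (1 + \<bar>y\<bar>) powr q) \<partial>lborel)"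
  have J: "(\<integral>\<^sup>+y. ennreal (std_normal_density y * (1 + \<bar>y\<bar>) powr q) \<partial>lborel) = ennreal J" "J \<ge> 0"
    using nn_integral_std_normal_moment_finite[of q] by (simp_all add: J_def)
  show "J ^ CARD('d) \<ge> 0" using J(2) by simp
  fix \<sigma> :: real assume \<sigma>: "\<sigma> > 0"
  define f where "f x = ennreal (normal_density 0 \<sigma> x * (1 + \<bar>x\<bar> / \<sigma>) powr q)" for x
  have [measurable]: "f \<in> borel_measurable borel" unfolding f_def by measurable
  have "(\<integral>\<^sup>+x. ennreal (\<Prod>i\<in>UNIV. normal_density 0 \<sigma> (x $ i)) *
       ennreal (norm (x :: real ^ 'd) powr q) \<partial>lborel)
     \<le> (\<integral>\<^sup>+x. ennreal (\<sigma> powr q) * (\<Prod>b\<in>Basis. f (x \<bullet> b)) \<partial>(lborel :: (real ^ 'd) measure))"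
  proof (intro nn_integral_mono)
    fix x :: "real ^ 'd"
    have "norm x powr q \<le> (\<sigma> * (\<Prod>i\<in>UNIV. (1 + \<bar>x $ i\<bar> / \<sigma>))) powr q"
      using norm_le_prod_coordinates[OF \<sigma>, of x] assms by (intro powr_mono2) auto
    also have "\<dots> = \<sigma> powr q * (\<Prod>i\<in>UNIV. (1 + \<bar>x $ i\<bar> / \<sigma>) powr q)"
      using \<sigma> by (subst powr_mult) (auto simp: prod_powr_distrib intro!: prod_nonneg)
    finally have "(\<Prod>i\<in>UNIV. normal_density 0 \<sigma> (x $ i)) * norm x powr q
      \<le> (\<Prod>i\<in>UNIV. normal_density 0 \<sigma> (x $ i)) * (\<sigma> powr q * (\<Prod>i\<in>UNIV. (1 + \<bar>x $ i\<bar> / \<sigma>) powr q))"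
      by (intro mult_left_mono prod_nonneg) auto
    also have "\<dots> = \<sigma> powr q * (\<Prod>i\<in>UNIV. normal_density 0 \<sigma> (x $ i) * (1 + \<bar>x $ i\<bar> / \<sigma>) powr q)"
      by (simp add: prod.distrib)
    finally have "ennreal ((\<Prod>i\<in>UNIV. normal_density 0 \<sigma> (x $ i)) * norm x powr q)
      \<le> ennreal (\<sigma> powr q) * (\<Prod>i\<in>UNIV. f (x $ i))"
      unfolding f_def by (subst prod_ennreal) (auto simp: ennreal_mult[symmetric] prod_nonneg ennreal_leI)
    moreover have "(\<Prod>b\<in>Basis. f (x \<bullet> b)) = (\<Prod>i\<in>UNIV. f (x $ i))"
      by (simp add: Basis_vec_def UNION_singleton_eq_range prod.reindex axis_eq_axis inj_on_def inner_axis)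
    ultimately show "ennreal (\<Prod>i\<in>UNIV. normal_density 0 \<sigma> (x $ i)) * ennreal (norm x powr q)
      \<le> ennreal (\<sigma> powr q) * (\<Prod>b\<in>Basis. f (x \<bullet> b))"
      by (subst ennreal_mult''[symmetric]) (auto intro: prod_nonneg)
  qed
  also have "\<dots> = ennreal (\<sigma> powr q) * (\<Prod>b\<in>(Basis :: (real ^ 'd) set). (\<integral>\<^sup>+y. f y \<partial>lborel))"
    by (subst nn_integral_cmult) (auto simp: nn_integral_lborel_prod[of "\<lambda>_. f"] simp del: prod_constant)
  also have "\<dots> = ennreal (\<sigma> powr q) * ennreal J ^ CARD('d)"
    unfolding f_def nn_integral_normal_scale[OF \<sigma>] J(1) by simp
  also have "\<dots> = ennreal (J ^ CARD('d) * \<sigma> powr q)"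
    using J(2) by (simp add: ennreal_power ennreal_mult' mult.commute)
  finally show "(\<integral>\<^sup>+x. ennreal (\<Prod>i\<in>UNIV. normal_density 0 \<sigma> (x $ i)) *
       ennreal (norm (x :: real ^ 'd) powr q) \<partial>lborel) \<le> ennreal (J ^ CARD('d) * \<sigma> powr q)" .
qed

lemma brownian_increment_moment:
  fixes B :: "real \<Rightarrow> 'w \<Rightarrow> real ^ 'd"
  assumes "brownian_motion M F B" "q > 0"
  obtains K where "K \<ge> 0"
    "\<And>s t. 0 \<le> s \<Longrightarrow> 0 \<le> t \<Longrightarrow>
       (\<integral>\<^sup>+ \<omega>. ennreal (norm (B t \<omega> - B s \<omega>) powr q) \<partial>M) \<le> ennreal (K * \<bar>t - s\<bar> powr (q / 2))"
proof -
  obtain K where K: "K \<ge> 0"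
    "\<And>\<sigma>. \<sigma> > 0 \<Longrightarrow> (\<integral>\<^sup>+x. ennreal (\<Prod>i\<in>UNIV. normal_density 0 \<sigma> (x $ i)) *
       ennreal (norm (x :: real ^ 'd) powr q) \<partial>lborel) \<le> ennreal (K * \<sigma> powr q)"
    using gaussian_norm_moment[of q] assms(2) by auto
  have less: "(\<integral>\<^sup>+ \<omega>. ennreal (norm (B t \<omega> - B s \<omega>) powr q) \<partial>M) \<le> ennreal (K * \<bar>t - s\<bar> powr (q / 2))"
    if "0 \<le> s" "s < t" for s t
  proof -
    have "distributed M lborel (\<lambda>\<omega>. B t \<omega> - B s \<omega>)
          (\<lambda>x. ennreal (\<Prod>i\<in>UNIV. normal_density 0 (sqrt (t - s)) (x $ i)))"
      using assms that by (simp add: brownian_motion_def)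
    from distributed_nn_integral[OF this, of "\<lambda>x. ennreal (norm x powr q)"]
    have "(\<integral>\<^sup>+ \<omega>. ennreal (norm (B t \<omega> - B s \<omega>) powr q) \<partial>M) =
      (\<integral>\<^sup>+x. ennreal (\<Prod>i\<in>UNIV. normal_density 0 (sqrt (t - s)) (x $ i)) *
       ennreal (norm (x :: real ^ 'd) powr q) \<partial>lborel)" by simp
    also have "\<dots> \<le> ennreal (K * sqrt (t - s) powr q)" using that by (intro K) auto
    also have "sqrt (t - s) powr q = \<bar>t - s\<bar> powr (q / 2)"
      using that by (simp add: powr_half_sqrt[symmetric] powr_powr)
    finally show ?thesis .
  qed
  show ?thesis
  proof (rule that[OF K(1)])
    fix s t :: real assume st: "0 \<le> s" "0 \<le> t"
    consider "s < t" | "t < s" | "s = t" by linarith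
    then show "(\<integral>\<^sup>+ \<omega>. ennreal (norm (B t \<omega> - B s \<omega>) powr q) \<partial>M) \<le> ennreal (K * \<bar>t - s\<bar> powr (q / 2))"
      using less[of s t] less[of t s] st by cases (simp_all add: norm_minus_commute abs_minus_commute)
  qed
qed

section \<open>Dyadic approximation\<close>

text \<open>The \<open>j\<close>-th point of the partition of \<open>[r, T]\<close> into \<open>2 ^ n\<close> intervals of equal length.\<close>

definition dyadic_point :: "real \<Rightarrow> real \<Rightarrow> nat \<Rightarrow> nat \<Rightarrow> real" where
  "dyadic_point r T n j = r + (T - r) * real j / 2 ^ n"

text \<open>
  The index of the last point of the \<open>n\<close>-th partition that is not larger than \<open>t\<close>, for
  \<open>t\<close> in \<open>[r, T]\<close>, and that point.
\<close>

definition dyadic_index :: "real \<Rightarrow> real \<Rightarrow> nat \<Rightarrow> real \<Rightarrow> nat" where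
  "dyadic_index r T n t = nat \<lfloor>(t - r) / (T - r) * 2 ^ n\<rfloor>"

definition dyadic_below :: "real \<Rightarrow> real \<Rightarrow> nat \<Rightarrow> real \<Rightarrow> real" where
  "dyadic_below r T n t = dyadic_point r T n (dyadic_index r T n t)"

lemma dyadic_point_Suc: "dyadic_point r T (Suc n) (2 * j) = dyadic_point r T n j"
  by (simp add: dyadic_point_def)

lemma dyadic_point_diff: "dyadic_point r T n (Suc i) - dyadic_point r T n i = (T - r) / 2 ^ n"
  by (simp add: dyadic_point_def field_simps)

context
  fixes r T :: real
  assumes rT: "r < T"
begin

lemma dyadic_point_in: "j \<le> 2 ^ n \<Longrightarrow> dyadic_point r T n j \<in> {r..T}"
proof -
  assume "j \<le> 2 ^ n"
  then have "real j \<le> 2 ^ n" by (metis of_nat_le_iff of_nat_numeral of_nat_power)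
  then have "(T - r) * (real j / 2 ^ n) \<le> (T - r) * 1"
    using rT by (intro mult_left_mono) auto
  then show ?thesis using rT by (simp add: dyadic_point_def)
qed

lemma of_nat_dyadic_index:
  "t \<in> {r..T} \<Longrightarrow> int (dyadic_index r T n t) = \<lfloor>(t - r) / (T - r) * 2 ^ n\<rfloor>"
  unfolding dyadic_index_def using rT by (subst int_nat_eq) auto

lemma dyadic_index_le:
  assumes "t \<in> {r..T}"
  shows "dyadic_index r T n t \<le> 2 ^ n"
proof -
  have "(t - r) / (T - r) * 2 ^ n \<le> 1 * 2 ^ n"
    using assms rT by (intro mult_right_mono) auto
  then have "\<lfloor>(t - r) / (T - r) * 2 ^ n\<rfloor> \<le> 2 ^ n"
    by (simp add: floor_le_iff)
  then have "int (dyadic_index r T n t) \<le> int (2 ^ n)" using of_nat_dyadic_index[OF assms] by simp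
  then show ?thesis by (simp only: of_nat_le_iff)
qed

lemma dyadic_below_in: "t \<in> {r..T} \<Longrightarrow> dyadic_below r T n t \<in> {r..T}"
  unfolding dyadic_below_def by (intro dyadic_point_in dyadic_index_le)

lemma dyadic_index_Suc:
  assumes "t \<in> {r..T}"
  shows "dyadic_index r T (Suc n) t = 2 * dyadic_index r T n t \<or>
         dyadic_index r T (Suc n) t = Suc (2 * dyadic_index r T n t)"
proof -
  define v where "v = (t - r) / (T - r) * 2 ^ n"
  have "\<lfloor>2 * v\<rfloor> = 2 * \<lfloor>v\<rfloor> \<or> \<lfloor>2 * v\<rfloor> = 2 * \<lfloor>v\<rfloor> + 1"
    by linarith
  then have "int (dyadic_index r T (Suc n) t) = 2 * int (dyadic_index r T n t) \<or>
             int (dyadic_index r T (Suc n) t) = 2 * int (dyadic_index r T n t) + 1"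
    using of_nat_dyadic_index[OF assms] by (simp add: v_def mult_ac)
  then show ?thesis by linarith
qed

lemma dyadic_index_neighbour:
  assumes "s \<in> {r..T}" "t \<in> {r..T}" "s \<le> t" "t - s \<le> (T - r) / 2 ^ n"
  shows "dyadic_index r T n t = dyadic_index r T n s \<or>
         dyadic_index r T n t = Suc (dyadic_index r T n s)"
proof -
  define v where "v = (s - r) / (T - r) * 2 ^ n"
  define w where "w = (t - r) / (T - r) * 2 ^ n"
  have "w - v = (t - s) * 2 ^ n / (T - r)"
    by (simp add: v_def w_def diff_divide_distrib[symmetric] left_diff_distrib[symmetric])
  moreover have "(t - s) * 2 ^ n \<le> T - r" using assms(4) by (simp add: field_simps)
  moreover have "0 \<le> (t - s) * 2 ^ n / (T - r)" using rT assms(3) by simp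
  ultimately have "w - v \<le> 1" "v \<le> w" using rT by auto
  then have "\<lfloor>w\<rfloor> = \<lfloor>v\<rfloor> \<or> \<lfloor>w\<rfloor> = \<lfloor>v\<rfloor> + 1"
    by linarith
  then show ?thesis
    using of_nat_dyadic_index[OF assms(1), of n] of_nat_dyadic_index[OF assms(2), of n]
    unfolding v_def w_def by linarith
qed

lemma dyadic_below_bounds:
  assumes "t \<in> {r..T}"
  shows "dyadic_below r T n t \<le> t" "t - dyadic_below r T n t \<le> (T - r) / 2 ^ n"
proof -
  define v where "v = (t - r) / (T - r) * 2 ^ n"
  have v: "real (dyadic_index r T n t) \<le> v" "v \<le> real (dyadic_index r T n t) + 1"
    using of_nat_dyadic_index[OF assms, of n] unfolding v_def by linarith+
  have t: "t = r + (T - r) * (v / 2 ^ n)" using rT by (simp add: v_def)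
  have "(T - r) * (real (dyadic_index r T n t) / 2 ^ n) \<le> (T - r) * (v / 2 ^ n)"
    using rT v by (intro mult_left_mono divide_right_mono) auto
  then show "dyadic_below r T n t \<le> t"
    by (subst t) (simp add: dyadic_below_def dyadic_point_def)
  have "(T - r) * (v / 2 ^ n) \<le> (T - r) * ((real (dyadic_index r T n t) + 1) / 2 ^ n)"
    using rT v by (intro mult_left_mono divide_right_mono) auto
  also have "\<dots> = (T - r) * (real (dyadic_index r T n t) / 2 ^ n) + (T - r) / 2 ^ n"
    by (simp add: add_divide_distrib distrib_left)
  finally show "t - dyadic_below r T n t \<le> (T - r) / 2 ^ n"
    by (subst (1) t) (simp add: dyadic_below_def dyadic_point_def)
qed

lemma dyadic_below_tendsto:
  assumes "t \<in> {r..T}"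
  shows "(\<lambda>n. dyadic_below r T n t) \<longlonglongrightarrow> t"
proof -
  have "(\<lambda>n. (T - r) * (1 / 2) ^ n) \<longlonglongrightarrow> (T - r) * 0"
    by (intro tendsto_intros LIMSEQ_power_zero) auto
  then have lim: "(\<lambda>n. (T - r) / 2 ^ n) \<longlonglongrightarrow> 0" by (simp add: power_divide)
  have "(\<lambda>n. t - dyadic_below r T n t) \<longlonglongrightarrow> 0"
  proof (rule tendsto_sandwich[OF _ _ tendsto_const lim])
    show "\<forall>\<^sub>F n in sequentially. 0 \<le> t - dyadic_below r T n t"
      using dyadic_below_bounds(1)[OF assms] by (intro always_eventually allI) (simp only: diff_ge_0_iff_ge)
    show "\<forall>\<^sub>F n in sequentially. t - dyadic_below r T n t \<le> (T - r) / 2 ^ n"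
      by (intro always_eventually allI dyadic_below_bounds(2) assms)
  qed
  from tendsto_diff[OF tendsto_const[of t] this] show ?thesis by simp
qed

text \<open>
  The approximations of one point on successive levels, and those of two nearby points on the same
  level, coincide or are neighbours in the partition.
\<close>

lemma dyadic_below_Suc_cases:
  assumes "t \<in> {r..T}" "\<And>x. P x x"
    and "\<And>i. i < 2 ^ Suc n \<Longrightarrow> P (dyadic_point r T (Suc n) i) (dyadic_point r T (Suc n) (Suc i))"
  shows "P (dyadic_below r T n t) (dyadic_below r T (Suc n) t)"
proof -
  have *: "dyadic_below r T n t = dyadic_point r T (Suc n) (2 * dyadic_index r T n t)"
    by (simp only: dyadic_below_def dyadic_point_Suc)
  show ?thesis
    using dyadic_index_Suc[OF assms(1), of n] dyadic_index_le[OF assms(1), of "Suc n"]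
      assms(2) assms(3)[of "2 * dyadic_index r T n t"]
    unfolding * unfolding dyadic_below_def by auto
qed

lemma dyadic_below_neighbour_cases:
  assumes "s \<in> {r..T}" "t \<in> {r..T}" "s \<le> t" "t - s \<le> (T - r) / 2 ^ n" "\<And>x. P x x"
    and "\<And>i. i < 2 ^ n \<Longrightarrow> P (dyadic_point r T n i) (dyadic_point r T n (Suc i))"
  shows "P (dyadic_below r T n s) (dyadic_below r T n t)"
  using dyadic_index_neighbour[OF assms(1-4)] dyadic_index_le[OF assms(2), of n] assms(5,6)
  unfolding dyadic_below_def by auto

text \<open>The level at which the chaining for the interval \<open>[s, t]\<close> starts.\<close>

lemma dyadic_scale:
  assumes "s \<in> {r..T}" "t \<in> {r..T}" "s < t"
  obtains m where "t - s \<le> (T - r) / 2 ^ m" "1 / 2 ^ m \<le> 2 / (T - r) * (t - s)"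
proof -
  define u where "u = (t - s) / (T - r)"
  have u: "0 < u" "u \<le> 1" using assms rT by (auto simp: u_def)
  have "\<exists>n. (1 / 2 :: real) ^ n < u" using u(1) by (intro real_arch_pow_inv) auto
  then obtain n where n: "(1 / 2) ^ n < u" and least: "\<And>k. k < n \<Longrightarrow> \<not> (1 / 2) ^ k < u"
    using exists_least_iff[of "\<lambda>n. (1 / 2 :: real) ^ n < u"] by blast
  from n u obtain m where m: "n = Suc m" by (cases n) auto
  then have "u \<le> (1 / 2) ^ m" using least[of m] by simp
  then have "u \<le> 1 / 2 ^ m" by (simp add: power_divide)
  then have "t - s \<le> (T - r) / 2 ^ m" using rT by (simp add: u_def field_simps)
  moreover have "1 / 2 ^ m \<le> 2 * u" using n m by (simp add: power_divide)
  ultimately show ?thesis by (intro that) (simp_all add: u_def)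
qed

end

section \<open>Chaining for controlled paths\<close>

lemma convergent_of_geometric_increments:
  fixes a :: "nat \<Rightarrow> 'b::banach"
  assumes "\<bar>\<theta>\<bar> < 1" "\<And>n. norm (a (Suc n) - a n) \<le> M * \<theta> ^ n"
  shows "convergent a"
proof -
  have "summable (\<lambda>n. M * \<theta> ^ n)"
    using assms(1) by (intro summable_mult summable_geometric) auto
  then have "summable (\<lambda>n. a (Suc n) - a n)"
    using assms(2) by (rule summable_comparison_test'[of _ 0])
  then have "convergent (\<lambda>n. \<Sum>i<n. a (Suc i) - a i)"
    by (simp add: summable_iff_convergent)
  then have "convergent (\<lambda>n. (a n - a 0) + a 0)"
    unfolding sum_lessThan_telescope by (intro convergent_add convergent_const)
  then show ?thesis by simp
qed

lemma geometric_partial_sum_le: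
  assumes "0 \<le> \<theta>" "\<theta> < (1::real)"
  shows "(\<Sum>j<k. \<theta> ^ j) \<le> 1 / (1 - \<theta>)"
  using assms by (subst sum_gp_strict) (auto intro!: divide_right_mono)

lemma remainder_chen:
  "remainder b x x' s t =
     remainder b x x' s u + remainder b x x' u t + blinfun_apply (x' u - x' s) (b t - b u)"
  by (simp add: remainder_def blinfun.diff_left blinfun.diff_right)

lemma remainder_same [simp]: "remainder b x x' s s = 0"
  by (simp add: remainder_def)

text \<open>
  The constants that the geometric sums with ratio \<open>\<theta>\<close> produce in the chaining bounds for
  increments and for remainders.
\<close>

definition chain_const :: "real \<Rightarrow> real" where
  "chain_const \<theta> = 1 + 2 / (1 - \<theta>)"

definition chain_rem_const :: "real \<Rightarrow> real" where
  "chain_rem_const \<theta> = 1 + (2 + 2 * chain_const \<theta>) / (1 - \<theta>)"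

context
  fixes r T \<theta> K :: real
  assumes rT: "r < T" and \<theta>: "0 < \<theta>" "\<theta> < 1" and K: "0 \<le> K"
begin

lemma increment_dyadic_below_Suc:
  fixes f :: "real \<Rightarrow> 'b::real_normed_vector"
  assumes "\<And>n i. i < 2 ^ n \<Longrightarrow>
      norm (f (dyadic_point r T n (Suc i)) - f (dyadic_point r T n i)) \<le> K * \<theta> ^ n"
    and "t \<in> {r..T}"
  shows "norm (f (dyadic_below r T (Suc n) t) - f (dyadic_below r T n t)) \<le> K * \<theta> ^ Suc n"
  by (rule dyadic_below_Suc_cases[OF rT assms(2), where P = "\<lambda>x y. norm (f y - f x) \<le> K * \<theta> ^ Suc n"])
     (use assms(1)[of _ "Suc n"] \<theta> K in auto)

lemma increment_chain:
  fixes f :: "real \<Rightarrow> 'b::real_normed_vector"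
  assumes f: "\<And>n i. i < 2 ^ n \<Longrightarrow>
      norm (f (dyadic_point r T n (Suc i)) - f (dyadic_point r T n i)) \<le> K * \<theta> ^ n"
    and st: "s \<in> {r..T}" "t \<in> {r..T}" "s \<le> t" "t - s \<le> (T - r) / 2 ^ m"
    and "n \<ge> m"
  shows "norm (f (dyadic_below r T n t) - f (dyadic_below r T n s)) \<le> chain_const \<theta> * K * \<theta> ^ m"
proof -
  have "norm (f (dyadic_below r T (m + k) t) - f (dyadic_below r T (m + k) s))
      \<le> K * \<theta> ^ m * (1 + 2 * (\<Sum>j<k. \<theta> ^ j))" for k
  proof (induction k)
    case 0
    have "norm (f (dyadic_below r T m t) - f (dyadic_below r T m s)) \<le> K * \<theta> ^ m"
      by (rule dyadic_below_neighbour_cases[OF rT st, where P = "\<lambda>x y. norm (f y - f x) \<le> K * \<theta> ^ m"])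
         (use f[of _ m] \<theta> K in auto)
    then show ?case by simp
  next
    case (Suc k)
    let ?s = "\<lambda>k. f (dyadic_below r T (m + k) s)" and ?t = "\<lambda>k. f (dyadic_below r T (m + k) t)"
    have "norm (?t (Suc k) - ?s (Suc k))
        \<le> norm (?t (Suc k) - ?t k) + norm (?t k - ?s k) + norm (?s (Suc k) - ?s k)"
      by norm
    also have "\<dots> \<le> K * \<theta> ^ Suc (m + k) + K * \<theta> ^ m * (1 + 2 * (\<Sum>j<k. \<theta> ^ j)) + K * \<theta> ^ Suc (m + k)"
      using increment_dyadic_below_Suc[of f, OF f st(1), of "m + k"]
        increment_dyadic_below_Suc[of f, OF f st(2), of "m + k"] Suc
      by (intro add_mono) simp_all
    also have "\<dots> \<le> K * \<theta> ^ m * (1 + 2 * (\<Sum>j<Suc k. \<theta> ^ j))"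
    proof -
      have "K * \<theta> ^ Suc (m + k) \<le> K * (\<theta> ^ m * \<theta> ^ k)"
        using \<theta> K by (intro mult_left_mono) (auto simp: power_add mult_left_le_one_le)
      then show ?thesis by (simp add: algebra_simps)
    qed
    finally show ?case .
  qed
  from this[of "n - m"] \<open>n \<ge> m\<close>
  have "norm (f (dyadic_below r T n t) - f (dyadic_below r T n s))
      \<le> K * \<theta> ^ m * (1 + 2 * (\<Sum>j<n-m. \<theta> ^ j))" by simp
  also have "\<dots> \<le> K * \<theta> ^ m * (1 + 2 * (1 / (1 - \<theta>)))"
    using geometric_partial_sum_le[of \<theta> "n - m"] \<theta> K by (intro mult_left_mono add_mono) auto
  finally show ?thesis by (simp add: chain_const_def mult_ac)
qed

context
  fixes b :: "real \<Rightarrow> real ^ 'd" and x :: "real \<Rightarrow> 'e::banach" and x' :: "real \<Rightarrow> (real ^ 'd) \<Rightarrow>\<^sub>L 'e"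
  assumes b: "\<And>n i. i < 2 ^ n \<Longrightarrow>
      norm (b (dyadic_point r T n (Suc i)) - b (dyadic_point r T n i)) \<le> K * \<theta> ^ n"
    and x': "\<And>n i. i < 2 ^ n \<Longrightarrow>
      norm (x' (dyadic_point r T n (Suc i)) - x' (dyadic_point r T n i)) \<le> K * \<theta> ^ n"
    and rem: "\<And>n i. i < 2 ^ n \<Longrightarrow>
      norm (remainder b x x' (dyadic_point r T n i) (dyadic_point r T n (Suc i))) \<le> (K * \<theta> ^ n)\<^sup>2"
begin

lemma remainder_dyadic_below_Suc:
  assumes "t \<in> {r..T}"
  shows "norm (remainder b x x' (dyadic_below r T n t) (dyadic_below r T (Suc n) t)) \<le> (K * \<theta> ^ Suc n)\<^sup>2"
  by (rule dyadic_below_Suc_cases[OF rT assms,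
        where P = "\<lambda>u v. norm (remainder b x x' u v) \<le> (K * \<theta> ^ Suc n)\<^sup>2"])
     (use rem[of _ "Suc n"] in auto)

text \<open>
  Refining both endpoints by one level changes the remainder, by Chen's relation, by two
  remainders of that level and two products of an increment of that level with an increment over
  the whole interval.  The latter is of the order of the scale \<open>m\<close> of the interval, which is what
  makes the total of order \<open>\<theta> ^ (2 * m)\<close>.
\<close>

lemma remainder_chain:
  assumes st: "s \<in> {r..T}" "t \<in> {r..T}" "s \<le> t" "t - s \<le> (T - r) / 2 ^ m"
    and "n \<ge> m"
  shows "norm (remainder b x x' (dyadic_below r T n s) (dyadic_below r T n t))
    \<le> chain_rem_const \<theta> * (K * \<theta> ^ m)\<^sup>2"
proof -
  let ?D = "2 + 2 * chain_const \<theta>"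
  have c: "chain_const \<theta> \<ge> 0" using \<theta> by (simp add: chain_const_def)
  have "norm (remainder b x x' (dyadic_below r T (m + k) s) (dyadic_below r T (m + k) t))
      \<le> (K * \<theta> ^ m)\<^sup>2 * (1 + ?D * (\<Sum>j<k. \<theta> ^ j))" for k
  proof (induction k)
    case 0
    have "norm (remainder b x x' (dyadic_below r T m s) (dyadic_below r T m t)) \<le> (K * \<theta> ^ m)\<^sup>2"
      by (rule dyadic_below_neighbour_cases[OF rT st,
            where P = "\<lambda>u v. norm (remainder b x x' u v) \<le> (K * \<theta> ^ m)\<^sup>2"])
         (use rem[of _ m] in auto)
    then show ?case by simp
  next
    case (Suc k)
    define s0 s1 t0 t1 where pts: "s0 = dyadic_below r T (m + k) s" "s1 = dyadic_below r T (m + Suc k) s"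
      "t0 = dyadic_below r T (m + k) t" "t1 = dyadic_below r T (m + Suc k) t"
    let ?R = "remainder b x x'" and ?e = "K * \<theta> ^ Suc (m + k)"
    have e: "0 \<le> ?e" "?e \<le> K * \<theta> ^ m * \<theta> ^ k" "?e \<le> K * \<theta> ^ m"
      using \<theta> K power_le_one[of \<theta> k] power_le_one[of \<theta> "Suc k"] mult_left_le[of "\<theta> ^ Suc k" "\<theta> ^ m"]
      by (auto simp: power_add mult_left_le_one_le mult_left_mono mult_ac intro!: mult_left_mono)
    have chen: "?R s1 t1 = ?R s0 t0 + ?R t0 t1 + blinfun_apply (x' t0 - x' s0) (b t1 - b t0)
        - ?R s0 s1 - blinfun_apply (x' s1 - x' s0) (b t1 - b s1)"
      using remainder_chen[of b x x' s0 t1 t0] remainder_chen[of b x x' s0 t1 s1]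
      by (simp add: algebra_simps)
    have "norm (?R s1 t1) = norm (?R s0 t0 + ?R t0 t1 + blinfun_apply (x' t0 - x' s0) (b t1 - b t0)
        - ?R s0 s1 - blinfun_apply (x' s1 - x' s0) (b t1 - b s1))"
      by (simp only: chen)
    also have "\<dots> \<le> norm (?R s0 t0) + norm (?R t0 t1)
        + norm (blinfun_apply (x' t0 - x' s0) (b t1 - b t0)) + norm (?R s0 s1)
        + norm (blinfun_apply (x' s1 - x' s0) (b t1 - b s1))"
      by norm
    also have "\<dots> \<le> norm (?R s0 t0) + norm (?R t0 t1)
        + norm (x' t0 - x' s0) * norm (b t1 - b t0) + norm (?R s0 s1)
        + norm (x' s1 - x' s0) * norm (b t1 - b s1)"
      by (intro add_mono norm_blinfun order_refl)
    also have "\<dots> \<le> (K * \<theta> ^ m)\<^sup>2 * (1 + ?D * (\<Sum>j<k. \<theta> ^ j)) + ?e\<^sup>2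
        + (chain_const \<theta> * K * \<theta> ^ m) * ?e + ?e\<^sup>2 + ?e * (chain_const \<theta> * K * \<theta> ^ m)"
    proof -
      have "norm (?R s0 t0) \<le> (K * \<theta> ^ m)\<^sup>2 * (1 + ?D * (\<Sum>j<k. \<theta> ^ j))"
        using Suc by (simp add: pts)
      moreover have "norm (?R t0 t1) \<le> ?e\<^sup>2" "norm (?R s0 s1) \<le> ?e\<^sup>2"
        using remainder_dyadic_below_Suc[OF st(1), of "m + k"] remainder_dyadic_below_Suc[OF st(2), of "m + k"]
        by (simp_all add: pts)
      moreover have xt: "norm (x' t0 - x' s0) \<le> chain_const \<theta> * K * \<theta> ^ m"
        unfolding pts by (rule increment_chain[OF x' st]) auto
      moreover have bt: "norm (b t1 - b s1) \<le> chain_const \<theta> * K * \<theta> ^ m"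
        unfolding pts by (rule increment_chain[OF b st]) auto
      moreover have "norm (b t1 - b t0) \<le> ?e" "norm (x' s1 - x' s0) \<le> ?e"
        using increment_dyadic_below_Suc[of b, OF b st(2), of "m + k"]
          increment_dyadic_below_Suc[of x', OF x' st(1), of "m + k"]
        by (simp_all add: pts)
      ultimately show ?thesis
        using e(1) order_trans[OF norm_ge_zero xt] by (intro add_mono mult_mono[OF _ _ _ norm_ge_zero]) assumption+
    qed
    also have "\<dots> \<le> (K * \<theta> ^ m)\<^sup>2 * (1 + ?D * (\<Sum>j<k. \<theta> ^ j))
        + ?D * ((K * \<theta> ^ m) * (K * \<theta> ^ m * \<theta> ^ k))"
    proof -
      have "?e\<^sup>2 \<le> (K * \<theta> ^ m) * (K * \<theta> ^ m * \<theta> ^ k)"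
        unfolding power2_eq_square using K \<theta> by (intro mult_mono[OF e(3) e(2) _ e(1)]) simp
      moreover have "(chain_const \<theta> * K * \<theta> ^ m) * ?e
          \<le> (chain_const \<theta> * K * \<theta> ^ m) * (K * \<theta> ^ m * \<theta> ^ k)"
        using c K \<theta> by (intro mult_left_mono[OF e(2)]) simp
      ultimately show ?thesis by (simp add: algebra_simps)
    qed
    also have "\<dots> = (K * \<theta> ^ m)\<^sup>2 * (1 + ?D * (\<Sum>j<Suc k. \<theta> ^ j))"
      by (simp add: algebra_simps power2_eq_square)
    finally show ?case by (simp add: pts)
  qed
  from this[of "n - m"] \<open>n \<ge> m\<close>
  have "norm (remainder b x x' (dyadic_below r T n s) (dyadic_below r T n t))
      \<le> (K * \<theta> ^ m)\<^sup>2 * (1 + ?D * (\<Sum>j<n-m. \<theta> ^ j))" by simp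
  also have "\<dots> \<le> (K * \<theta> ^ m)\<^sup>2 * (1 + ?D * (1 / (1 - \<theta>)))"
    using geometric_partial_sum_le[of \<theta> "n - m"] \<theta> c by (intro mult_left_mono add_mono) auto
  finally show ?thesis by (simp add: chain_rem_const_def mult_ac)
qed

text \<open>
  The increments of \<open>x\<close> along the approximations are geometrically small, because those of the
  remainder are and \<open>x'\<close> stays bounded.
\<close>

lemma dyadic_limits_convergent:
  assumes "t \<in> {r..T}"
  shows "convergent (\<lambda>n. x' (dyadic_below r T n t))" "convergent (\<lambda>n. x (dyadic_below r T n t))"
proof -
  let ?t = "\<lambda>n. dyadic_below r T n t"
  show conv: "convergent (\<lambda>n. x' (?t n))"
    by (rule convergent_of_geometric_increments[of \<theta> _ "K * \<theta>"])
       (use increment_dyadic_below_Suc[of x', OF x' assms] \<theta> in \<open>auto simp: mult_ac\<close>)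
  then obtain C where C: "\<And>n. norm (x' (?t n)) \<le> C"
    using convergent_imp_Bseq[OF conv] by (auto simp: Bseq_def)
  show "convergent (\<lambda>n. x (?t n))"
  proof (rule convergent_of_geometric_increments[of \<theta> _ "K\<^sup>2 + C * K"])
    fix n
    have "norm (x (?t (Suc n)) - x (?t n))
      \<le> norm (remainder b x x' (?t n) (?t (Suc n))) + norm (x' (?t n)) * norm (b (?t (Suc n)) - b (?t n))"
      using norm_triangle_ineq[of "remainder b x x' (?t n) (?t (Suc n))"
          "blinfun_apply (x' (?t n)) (b (?t (Suc n)) - b (?t n))"]
        norm_blinfun[of "x' (?t n)" "b (?t (Suc n)) - b (?t n)"]
      by (simp add: remainder_def)
    also have "\<dots> \<le> (K * \<theta> ^ Suc n)\<^sup>2 + C * (K * \<theta> ^ Suc n)"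
      using remainder_dyadic_below_Suc[OF assms, of n] C[of n] order_trans[OF norm_ge_zero C]
        increment_dyadic_below_Suc[of b, OF b assms, of n]
      by (intro add_mono mult_mono) auto
    also have "\<dots> \<le> K\<^sup>2 * \<theta> ^ n + C * (K * \<theta> ^ n)"
    proof (intro add_mono mult_left_mono)
      have "\<theta> ^ Suc n * \<theta> ^ Suc n \<le> 1 * \<theta> ^ n"
        using \<theta> by (intro mult_mono) (auto simp: power_le_one mult_le_one mult_left_le_one_le)
      then have "K\<^sup>2 * (\<theta> ^ Suc n * \<theta> ^ Suc n) \<le> K\<^sup>2 * (1 * \<theta> ^ n)"
        by (rule mult_left_mono) simp
      then show "(K * \<theta> ^ Suc n)\<^sup>2 \<le> K\<^sup>2 * \<theta> ^ n"
        by (simp add: power2_eq_square mult_ac)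
    qed (use \<theta> K order_trans[OF norm_ge_zero C] in \<open>auto simp: mult_left_le_one_le\<close>)
    finally show "norm (x (?t (Suc n)) - x (?t n)) \<le> (K\<^sup>2 + C * K) * \<theta> ^ n"
      by (simp add: algebra_simps)
  qed (use \<theta> in auto)
qed

end

end

section \<open>Hoelder bounds for the limit paths\<close>

text \<open>
  The constants in the Hoelder bounds of exponent \<open>\<alpha>\<close> for increments and \<open>2 * \<alpha>\<close> for remainders;
  the chaining ratio is \<open>2 powr -\<alpha>\<close>.  The square in the second constant accounts for the product in
  Chen's relation when the time points are in decreasing order.
\<close>

definition chain_holder_const :: "real \<Rightarrow> real \<Rightarrow> real \<Rightarrow> real" where
  "chain_holder_const r T \<alpha> = chain_const (2 powr -\<alpha>) * (2 / (T - r)) powr \<alpha>"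

definition chain_holder_rem_const :: "real \<Rightarrow> real \<Rightarrow> real \<Rightarrow> real" where
  "chain_holder_rem_const r T \<alpha> =
     chain_rem_const (2 powr -\<alpha>) * (2 / (T - r)) powr (2 * \<alpha>) + (chain_holder_const r T \<alpha>)\<^sup>2"

lemma powr_ratio_bounds: "0 < \<alpha> \<Longrightarrow> 0 < 2 powr -\<alpha> \<and> 2 powr -\<alpha> < (1::real)"
  by (auto intro: powr_less_one)

lemma chain_const_nonneg: "0 < \<alpha> \<Longrightarrow> 0 \<le> chain_const (2 powr -\<alpha>)"
  using powr_ratio_bounds[of \<alpha>] by (simp add: chain_const_def)

lemma chain_rem_const_nonneg: "0 < \<alpha> \<Longrightarrow> 0 \<le> chain_rem_const (2 powr -\<alpha>)"
  using powr_ratio_bounds[of \<alpha>] chain_const_nonneg[of \<alpha>] by (simp add: chain_rem_const_def)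

lemma chain_holder_const_nonneg: "0 < \<alpha> \<Longrightarrow> 0 \<le> chain_holder_const r T \<alpha>"
  by (simp add: chain_holder_const_def chain_const_nonneg)

lemma chain_holder_rem_const_nonneg: "0 < \<alpha> \<Longrightarrow> 0 \<le> chain_holder_rem_const r T \<alpha>"
  by (simp add: chain_holder_rem_const_def chain_rem_const_nonneg)

lemma powr_ratio_power_le:
  fixes \<alpha> c h :: real
  assumes "0 < \<alpha>" "1 / 2 ^ m \<le> c * h" "0 \<le> h" "0 \<le> c"
  shows "(2 powr -\<alpha>) ^ m \<le> c powr \<alpha> * h powr \<alpha>"
proof -
  have "(2 powr -\<alpha>) ^ m = (1 / 2 ^ m :: real) powr \<alpha>"
    by (simp add: powr_minus_divide powr_divide power_divide powr_realpow[symmetric] powr_powr mult.commute)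
  also have "\<dots> \<le> (c * h) powr \<alpha>" using assms by (intro powr_mono2) auto
  finally show ?thesis using assms by (simp add: powr_mult)
qed

context
  fixes r T \<alpha> K :: real
  assumes rT: "r < T" and \<alpha>: "0 < \<alpha>" and K: "0 \<le> K"
begin

lemma increment_limit_holder:
  fixes f g :: "real \<Rightarrow> 'b::real_normed_vector"
  assumes f: "\<And>n i. i < 2 ^ n \<Longrightarrow>
      norm (f (dyadic_point r T n (Suc i)) - f (dyadic_point r T n i)) \<le> K * (2 powr -\<alpha>) ^ n"
    and g: "\<And>t. t \<in> {r..T} \<Longrightarrow> (\<lambda>n. f (dyadic_below r T n t)) \<longlonglongrightarrow> g t"
    and st: "s \<in> {r..T}" "t \<in> {r..T}"
  shows "norm (g t - g s) \<le> chain_holder_const r T \<alpha> * K * \<bar>t - s\<bar> powr \<alpha>"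
proof -
  have less: "norm (g t - g s) \<le> chain_holder_const r T \<alpha> * K * \<bar>t - s\<bar> powr \<alpha>"
    if st: "s \<in> {r..T}" "t \<in> {r..T}" "s < t" for s t
  proof -
    obtain m where m: "t - s \<le> (T - r) / 2 ^ m" "1 / 2 ^ m \<le> 2 / (T - r) * (t - s)"
      using dyadic_scale[OF rT st] by blast
    have "(\<lambda>n. norm (f (dyadic_below r T n t) - f (dyadic_below r T n s))) \<longlonglongrightarrow> norm (g t - g s)"
      by (intro tendsto_intros g st)
    then have "norm (g t - g s) \<le> chain_const (2 powr -\<alpha>) * K * (2 powr -\<alpha>) ^ m"
    proof (rule LIMSEQ_le_const2, intro exI allI impI)
      fix n assume "m \<le> n"
      then show "norm (f (dyadic_below r T n t) - f (dyadic_below r T n s))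
          \<le> chain_const (2 powr -\<alpha>) * K * (2 powr -\<alpha>) ^ m"
        using powr_ratio_bounds[OF \<alpha>] st m(1) K f
        by (intro increment_chain[OF rT]) simp_all
    qed
    also have "\<dots> \<le> chain_const (2 powr -\<alpha>) * K * ((2 / (T - r)) powr \<alpha> * (t - s) powr \<alpha>)"
      using chain_const_nonneg[OF \<alpha>] K \<alpha> m(2) st rT
      by (intro mult_left_mono powr_ratio_power_le) auto
    finally show ?thesis using st by (simp add: chain_holder_const_def mult_ac)
  qed
  consider "s < t" | "t < s" | "s = t" by linarith
  then show ?thesis
    using less[OF st] less[OF st(2,1)] by cases (simp_all add: norm_minus_commute abs_minus_commute)
qed

lemma remainder_limit_holder:
  fixes b :: "real \<Rightarrow> real ^ 'd" and x y :: "real \<Rightarrow> 'e::banach" and x' y' :: "real \<Rightarrow> (real ^ 'd) \<Rightarrow>\<^sub>L 'e"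
  assumes b: "\<And>n i. i < 2 ^ n \<Longrightarrow>
      norm (b (dyadic_point r T n (Suc i)) - b (dyadic_point r T n i)) \<le> K * (2 powr -\<alpha>) ^ n"
    and x': "\<And>n i. i < 2 ^ n \<Longrightarrow>
      norm (x' (dyadic_point r T n (Suc i)) - x' (dyadic_point r T n i)) \<le> K * (2 powr -\<alpha>) ^ n"
    and rem: "\<And>n i. i < 2 ^ n \<Longrightarrow>
      norm (remainder b x x' (dyadic_point r T n i) (dyadic_point r T n (Suc i))) \<le> (K * (2 powr -\<alpha>) ^ n)\<^sup>2"
    and lim: "\<And>t. t \<in> {r..T} \<Longrightarrow> (\<lambda>n. b (dyadic_below r T n t)) \<longlonglongrightarrow> b t"
      "\<And>t. t \<in> {r..T} \<Longrightarrow> (\<lambda>n. x (dyadic_below r T n t)) \<longlonglongrightarrow> y t"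
      "\<And>t. t \<in> {r..T} \<Longrightarrow> (\<lambda>n. x' (dyadic_below r T n t)) \<longlonglongrightarrow> y' t"
    and st: "s \<in> {r..T}" "t \<in> {r..T}"
  shows "norm (remainder b y y' s t) \<le> chain_holder_rem_const r T \<alpha> * K\<^sup>2 * \<bar>t - s\<bar> powr (2 * \<alpha>)"
proof -
  let ?C = "chain_rem_const (2 powr -\<alpha>)" and ?H = "chain_holder_const r T \<alpha>"
  have less: "norm (remainder b y y' s t) \<le> ?C * (2 / (T - r)) powr (2 * \<alpha>) * (K\<^sup>2 * \<bar>t - s\<bar> powr (2 * \<alpha>))"
    if st: "s \<in> {r..T}" "t \<in> {r..T}" "s < t" for s t
  proof -
    obtain m where m: "t - s \<le> (T - r) / 2 ^ m" "1 / 2 ^ m \<le> 2 / (T - r) * (t - s)"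
      using dyadic_scale[OF rT st] by blast
    have "(\<lambda>n. norm (remainder b x x' (dyadic_below r T n s) (dyadic_below r T n t)))
        \<longlonglongrightarrow> norm (remainder b y y' s t)"
      unfolding remainder_def by (intro tendsto_intros lim st)
    then have "norm (remainder b y y' s t) \<le> ?C * (K * (2 powr -\<alpha>) ^ m)\<^sup>2"
    proof (rule LIMSEQ_le_const2, intro exI allI impI)
      fix n assume "m \<le> n"
      then show "norm (remainder b x x' (dyadic_below r T n s) (dyadic_below r T n t))
          \<le> ?C * (K * (2 powr -\<alpha>) ^ m)\<^sup>2"
        using powr_ratio_bounds[OF \<alpha>] st m(1) K b x' rem
        by (intro remainder_chain[OF rT]) simp_all
    qed
    also have "\<dots> \<le> ?C * (K * ((2 / (T - r)) powr \<alpha> * (t - s) powr \<alpha>))\<^sup>2"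
      using chain_rem_const_nonneg[OF \<alpha>] K \<alpha> m(2) st rT
      by (intro mult_left_mono power_mono powr_ratio_power_le) auto
    also have "(K * ((2 / (T - r)) powr \<alpha> * (t - s) powr \<alpha>))\<^sup>2
        = K\<^sup>2 * ((2 / (T - r)) powr (2 * \<alpha>) * (t - s) powr (2 * \<alpha>))"
      by (simp add: power2_eq_square powr_add[symmetric] mult_2 mult_ac)
    finally show ?thesis using st by (simp add: mult_ac)
  qed
  consider "s < t" | "t < s" | "s = t" by linarith
  then show ?thesis
  proof cases
    case 1
    have "norm (remainder b y y' s t) \<le> ?C * (2 / (T - r)) powr (2 * \<alpha>) * (K\<^sup>2 * \<bar>t - s\<bar> powr (2 * \<alpha>))"
      by (rule less[OF st 1])
    also have "\<dots> \<le> chain_holder_rem_const r T \<alpha> * (K\<^sup>2 * \<bar>t - s\<bar> powr (2 * \<alpha>))"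
      by (intro mult_right_mono) (simp_all add: chain_holder_rem_const_def)
    finally show ?thesis by (simp add: mult_ac)
  next
    case 2
    \<comment> \<open>Chen's relation for s, t, s expresses the backward remainder by the forward one\<close>
    have "remainder b y y' s t = - remainder b y y' t s - blinfun_apply (y' t - y' s) (b s - b t)"
      using remainder_chen[of b y y' s s t] by (simp add: eq_neg_iff_add_eq_0 algebra_simps)
    then have "norm (remainder b y y' s t)
        \<le> norm (remainder b y y' t s) + norm (blinfun_apply (y' t - y' s) (b s - b t))"
      by (metis norm_minus_cancel norm_triangle_ineq4)
    also have "\<dots> \<le> norm (remainder b y y' t s) + norm (y' t - y' s) * norm (b s - b t)"
      by (intro add_mono norm_blinfun order_refl)
    also have "\<dots> \<le> ?C * (2 / (T - r)) powr (2 * \<alpha>) * (K\<^sup>2 * \<bar>s - t\<bar> powr (2 * \<alpha>))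
        + (?H * K * \<bar>t - s\<bar> powr \<alpha>) * (?H * K * \<bar>s - t\<bar> powr \<alpha>)"
      using less[OF st(2,1) 2] increment_limit_holder[of x' y', OF x' lim(3) st]
        increment_limit_holder[of b b, OF b lim(1) st(2,1)] chain_holder_const_nonneg[OF \<alpha>] K
      by (intro add_mono mult_mono) auto
    also have "(?H * K * \<bar>t - s\<bar> powr \<alpha>) * (?H * K * \<bar>s - t\<bar> powr \<alpha>)
        = ?H\<^sup>2 * (K\<^sup>2 * \<bar>s - t\<bar> powr (2 * \<alpha>))"
      unfolding mult_2[of \<alpha>] powr_add by (simp add: abs_minus_commute[of t s] power2_eq_square mult_ac)
    also have "?C * (2 / (T - r)) powr (2 * \<alpha>) * (K\<^sup>2 * \<bar>s - t\<bar> powr (2 * \<alpha>)) + \<dots>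
        = chain_holder_rem_const r T \<alpha> * K\<^sup>2 * \<bar>t - s\<bar> powr (2 * \<alpha>)"
      by (simp add: chain_holder_rem_const_def abs_minus_commute[of t s] algebra_simps)
    finally show ?thesis .
  qed (simp add: remainder_def)
qed

end

lemma holder_on_of_remainder_bound:
  fixes b :: "real \<Rightarrow> real ^ 'd" and x :: "real \<Rightarrow> 'e::banach" and x' :: "real \<Rightarrow> (real ^ 'd) \<Rightarrow>\<^sub>L 'e"
  assumes "r < T" "0 < \<alpha>" "0 \<le> c"
    and b: "\<And>s t. s \<in> {r..T} \<Longrightarrow> t \<in> {r..T} \<Longrightarrow> norm (b t - b s) \<le> c * \<bar>t - s\<bar> powr \<alpha>"
    and x': "\<And>s t. s \<in> {r..T} \<Longrightarrow> t \<in> {r..T} \<Longrightarrow> norm (x' t - x' s) \<le> c * \<bar>t - s\<bar> powr \<alpha>"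
    and rem: "\<And>s t. s \<in> {r..T} \<Longrightarrow> t \<in> {r..T} \<Longrightarrow>
      norm (remainder b x x' s t) \<le> D * \<bar>t - s\<bar> powr (2 * \<alpha>)"
    and "0 \<le> D"
  shows "holder_on \<alpha> {r..T} x"
  unfolding holder_on_def
proof (intro exI ballI)
  fix s t assume st: "s \<in> {r..T}" "t \<in> {r..T}"
  let ?h = "\<bar>t - s\<bar> powr \<alpha>" and ?L = "(T - r) powr \<alpha>"
  have h: "?h \<le> ?L" using st assms(2) by (intro powr_mono2) auto
  have "\<bar>s - r\<bar> powr \<alpha> \<le> ?L" using st assms(2) by (intro powr_mono2) auto
  then have "norm (x' s - x' r) \<le> c * ?L"
    using x'[of r s] st assms(1,3) mult_left_mono[of "\<bar>s - r\<bar> powr \<alpha>" ?L c] by auto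
  then have x's: "norm (x' s) \<le> norm (x' r) + c * ?L"
    using norm_triangle_ineq2[of "x' s" "x' r"] by linarith
  have "norm (x t - x s) \<le> norm (remainder b x x' s t) + norm (x' s) * norm (b t - b s)"
    using norm_triangle_ineq[of "remainder b x x' s t" "blinfun_apply (x' s) (b t - b s)"]
      norm_blinfun[of "x' s" "b t - b s"]
    by (simp add: remainder_def)
  also have "\<dots> \<le> D * (?h * ?L) + (norm (x' r) + c * ?L) * (c * ?h)"
  proof (rule add_mono)
    have "norm (remainder b x x' s t) \<le> D * (?h * ?h)"
      using rem[OF st] unfolding mult_2[of \<alpha>] powr_add .
    also have "\<dots> \<le> D * (?h * ?L)"
      using mult_left_mono[OF mult_left_mono[OF h powr_ge_zero] \<open>0 \<le> D\<close>] .
    finally show "norm (remainder b x x' s t) \<le> D * (?h * ?L)" .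
    show "norm (x' s) * norm (b t - b s) \<le> (norm (x' r) + c * ?L) * (c * ?h)"
      by (rule mult_mono[OF x's b[OF st] order_trans[OF norm_ge_zero x's] norm_ge_zero])
  qed
  finally show "norm (x t - x s) \<le> (D * ?L + (norm (x' r) + c * ?L) * c) * ?h"
    by (simp add: algebra_simps)
qed

section \<open>Dyadic moment sums\<close>

lemma nn_integral_dyadic_sum_finite:
  fixes X :: "nat \<Rightarrow> nat \<Rightarrow> 'w \<Rightarrow> ennreal"
  assumes meas: "\<And>n i. i < 2 ^ n \<Longrightarrow> X n i \<in> borel_measurable M"
    and bound: "\<And>n i. i < 2 ^ n \<Longrightarrow> (\<integral>\<^sup>+\<omega>. X n i \<omega> \<partial>M) \<le> ennreal (D * (2 powr -\<gamma>) ^ n)"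
    and "1 + p < \<gamma>" "0 \<le> D"
  shows "(\<integral>\<^sup>+\<omega>. (\<Sum>n. \<Sum>i<2 ^ n. ennreal ((2 powr p) ^ n) * X n i \<omega>) \<partial>M) < \<infinity>"
proof -
  define \<rho> where "\<rho> = 2 * 2 powr p * 2 powr -\<gamma>"
  have "\<rho> = 2 powr (1 + p - \<gamma>)" by (simp add: \<rho>_def powr_add powr_diff powr_minus_divide)
  then have \<rho>: "0 \<le> \<rho>" "\<rho> < 1" using assms(3) powr_less_one[of 2 "1 + p - \<gamma>"] by auto
  have "(\<integral>\<^sup>+\<omega>. (\<Sum>n. \<Sum>i<2 ^ n. ennreal ((2 powr p) ^ n) * X n i \<omega>) \<partial>M)
    = (\<Sum>n. \<Sum>i<2 ^ n. ennreal ((2 powr p) ^ n) * (\<integral>\<^sup>+\<omega>. X n i \<omega> \<partial>M))"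
  proof -
    have weighted: "(\<lambda>\<omega>. ennreal ((2 powr p) ^ n) * X n i \<omega>) \<in> borel_measurable M" if "i < 2 ^ n" for n i
      using meas[OF that] by measurable
    have "(\<integral>\<^sup>+\<omega>. (\<Sum>n. \<Sum>i<2 ^ n. ennreal ((2 powr p) ^ n) * X n i \<omega>) \<partial>M)
      = (\<Sum>n. \<integral>\<^sup>+\<omega>. (\<Sum>i<2 ^ n. ennreal ((2 powr p) ^ n) * X n i \<omega>) \<partial>M)"
      by (rule nn_integral_suminf) (intro borel_measurable_sum weighted, simp)
    also have "\<dots> = (\<Sum>n. \<Sum>i<2 ^ n. \<integral>\<^sup>+\<omega>. ennreal ((2 powr p) ^ n) * X n i \<omega> \<partial>M)"
      by (intro arg_cong[of _ _ suminf] ext nn_integral_sum weighted) simp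
    also have "\<dots> = (\<Sum>n. \<Sum>i<2 ^ n. ennreal ((2 powr p) ^ n) * (\<integral>\<^sup>+\<omega>. X n i \<omega> \<partial>M))"
      by (intro arg_cong[of _ _ suminf] ext sum.cong refl nn_integral_cmult meas) simp
    finally show ?thesis .
  qed
  also have "\<dots> \<le> (\<Sum>n. ennreal (D * \<rho> ^ n))"
  proof (intro suminf_le)
    fix n
    have "(\<Sum>i<2 ^ n. ennreal ((2 powr p) ^ n) * (\<integral>\<^sup>+\<omega>. X n i \<omega> \<partial>M))
      \<le> (\<Sum>i<(2::nat) ^ n. ennreal ((2 powr p) ^ n) * ennreal (D * (2 powr -\<gamma>) ^ n))"
      by (intro sum_mono mult_left_mono bound) simp_all
    also have "\<dots> = ennreal (2 ^ n * ((2 powr p) ^ n * (D * (2 powr -\<gamma>) ^ n)))"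
      using \<open>0 \<le> D\<close> by (simp add: ennreal_mult[symmetric] ennreal_of_nat_eq_real_of_nat)
    also have "2 ^ n * ((2 powr p) ^ n * (D * (2 powr -\<gamma>) ^ n)) = D * \<rho> ^ n"
      by (simp add: \<rho>_def power_mult_distrib)
    finally show "(\<Sum>i<2 ^ n. ennreal ((2 powr p) ^ n) * (\<integral>\<^sup>+\<omega>. X n i \<omega> \<partial>M)) \<le> ennreal (D * \<rho> ^ n)" .
  qed auto
  also have "\<dots> < \<infinity>"
    using \<rho> \<open>0 \<le> D\<close> by (subst suminf_ennreal2) (auto intro!: summable_mult summable_geometric)
  finally show ?thesis .
qed

lemma AE_tendsto_zero_of_geometric_moments:
  fixes X :: "nat \<Rightarrow> 'w \<Rightarrow> real"
  assumes [measurable]: "\<And>n. X n \<in> borel_measurable M" and nonneg: "\<And>n \<omega>. 0 \<le> X n \<omega>"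
    and bound: "\<And>n. (\<integral>\<^sup>+\<omega>. ennreal (X n \<omega> powr p) \<partial>M) \<le> ennreal (D * \<rho> ^ n)"
    and "0 \<le> \<rho>" "\<rho> < 1" "0 \<le> D" "0 < p"
  shows "AE \<omega> in M. (\<lambda>n. X n \<omega>) \<longlonglongrightarrow> 0"
proof -
  have "(\<integral>\<^sup>+\<omega>. (\<Sum>n. ennreal (X n \<omega> powr p)) \<partial>M) = (\<Sum>n. \<integral>\<^sup>+\<omega>. ennreal (X n \<omega> powr p) \<partial>M)"
    by (rule nn_integral_suminf) simp
  also have "\<dots> \<le> (\<Sum>n. ennreal (D * \<rho> ^ n))"
    by (intro suminf_le bound) auto
  also have "\<dots> < \<infinity>"
    using assms(4-6) by (subst suminf_ennreal2) (auto intro!: summable_mult summable_geometric)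
  finally have "(\<integral>\<^sup>+\<omega>. (\<Sum>n. ennreal (X n \<omega> powr p)) \<partial>M) \<noteq> \<infinity>" by simp
  then have "AE \<omega> in M. (\<Sum>n. ennreal (X n \<omega> powr p)) \<noteq> \<infinity>"
    by (rule nn_integral_PInf_AE[rotated]) simp
  then show ?thesis
  proof eventually_elim
    case (elim \<omega>)
    then have "summable (\<lambda>n. X n \<omega> powr p)"
      by (intro summable_suminf_not_top) auto
    then have "(\<lambda>n. X n \<omega> powr p) \<longlonglongrightarrow> 0" by (rule summable_LIMSEQ_zero)
    then have "(\<lambda>n. (X n \<omega> powr p) powr (1 / p)) \<longlonglongrightarrow> 0"
      using \<open>0 < p\<close> by (intro tendsto_zero_powrI[where f = "\<lambda>n. X n \<omega> powr p" and g = "\<lambda>_. 1 / p" and b = "1 / p"]) auto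
    then show ?case using nonneg \<open>0 < p\<close> by (simp add: powr_powr)
  qed
qed

text \<open>
  Turns a bound by \<open>a\<close> on one weighted term of level \<open>n\<close> of the dyadic sum into a bound on the
  increment itself.
\<close>

lemma le_root_of_weighted_power_le:
  fixes u a q \<alpha> :: real
  assumes "0 \<le> u" "0 < q" "(2 powr (q * \<alpha>)) ^ n * u powr q \<le> a"
  shows "u \<le> a powr (1 / q) * (2 powr -\<alpha>) ^ n"
proof -
  have "u powr q \<le> a * (2 powr -(q * \<alpha>)) ^ n"
    using assms(3) by (simp add: powr_minus_divide power_divide field_simps)
  moreover have "0 \<le> a"
    using assms(3) by (rule order_trans[rotated]) simp
  ultimately have "(u powr q) powr (1 / q) \<le> (a * (2 powr -(q * \<alpha>)) ^ n) powr (1 / q)"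
    using assms(2) by (intro powr_mono2) auto
  also have "\<dots> = a powr (1 / q) * (2 powr -\<alpha>) ^ n"
    using assms(2) \<open>0 \<le> a\<close> by (simp add: powr_mult powr_realpow[symmetric] powr_powr)
  finally show ?thesis using assms by (simp add: powr_powr)
qed

lemma powr_dyadic_scale:
  assumes "0 < (L::real)"
  shows "(L / 2 ^ n) powr \<gamma> = L powr \<gamma> * (2 powr -\<gamma>) ^ n"
  using assms by (simp add: powr_divide powr_minus_divide power_divide powr_realpow[symmetric] powr_powr mult.commute)

lemma add_one_powr_le:
  assumes "0 \<le> (u::real)" "0 < p"
  shows "(u + 1) powr p \<le> 2 powr p * (u powr p + 1)"
proof -
  have "(u + 1) powr p \<le> (2 * max u 1) powr p" using assms by (intro powr_mono2) auto
  also have "\<dots> = 2 powr p * max u 1 powr p" using assms by (simp add: powr_mult)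
  also have "max u 1 powr p \<le> u powr p + 1" by (auto simp: max_def)
  finally show ?thesis by (simp add: mult_left_mono)
qed

section \<open>Existence of controlled versions\<close>

text \<open>
  One pair of versions carries both the integrable bound for the remainder and the Hoelder
  regularity of the paths.  Here \<open>I\<close> is any strongly measurable process with the stated moments.
\<close>

lemma controlled_versions_exist:
  fixes M :: "'w measure" and B :: "real \<Rightarrow> 'w \<Rightarrow> real ^ 'd"
    and Q :: "real \<Rightarrow> 'w \<Rightarrow> (real ^ 'd) \<Rightarrow>\<^sub>L 'e::banach" and I :: "real \<Rightarrow> 'w \<Rightarrow> 'e"
    and r T q \<alpha> \<beta> C :: real
  assumes BM: "brownian_motion M F B" and r: "0 < r" "r < T"
    and Q: "\<And>t. t \<in> {r..T} \<Longrightarrow> strongly_measurable M (Q t)"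
    and I: "\<And>t. t \<in> {r..T} \<Longrightarrow> strongly_measurable M (I t)"
    and q: "q > 2" and "\<beta> \<le> 1 / 2" and "C > 0"
    and Q_moment: "\<And>s t. s \<in> {r..T} \<Longrightarrow> t \<in> {r..T} \<Longrightarrow>
           (\<integral>\<^sup>+ \<omega>. ennreal (norm (Q t \<omega> - Q s \<omega>) powr q) \<partial>M) \<le> ennreal (C * \<bar>t - s\<bar> powr (q * \<beta>))"
    and R_moment: "\<And>s t. s \<in> {r..T} \<Longrightarrow> t \<in> {r..T} \<Longrightarrow>
           (\<integral>\<^sup>+ \<omega>. ennreal (norm (remainder (\<lambda>u. B u \<omega>) (\<lambda>u. I u \<omega>) (\<lambda>u. Q u \<omega>) s t) powr (q / 2)) \<partial>M)
             \<le> ennreal (C * \<bar>t - s\<bar> powr (q * \<beta>))"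
    and \<alpha>: "0 < \<alpha>" "\<alpha> < \<beta> - 1 / q"
  obtains Q' I' k where
    "is_version M {r..T} Q Q'" "is_version M {r..T} I I'"
    "k \<in> borel_measurable M" "\<And>\<omega>. \<omega> \<in> space M \<Longrightarrow> 0 < k \<omega>"
    "(\<integral>\<^sup>+ \<omega>. ennreal (k \<omega> powr (q / 2)) \<partial>M) < \<infinity>"
    "\<And>\<omega>. \<omega> \<in> space M \<Longrightarrow> holder_on \<alpha> {r..T} (\<lambda>t. Q' t \<omega>)"
    "\<And>\<omega>. \<omega> \<in> space M \<Longrightarrow> holder_on \<alpha> {r..T} (\<lambda>t. I' t \<omega>)"
    "AE \<omega> in M. \<forall>s\<in>{r..T}. \<forall>t\<in>{r..T}.
       norm (remainder (\<lambda>u. B u \<omega>) (\<lambda>u. I' u \<omega>) (\<lambda>u. Q' u \<omega>) s t) \<le> k \<omega> * \<bar>t - s\<bar> powr (2 * \<alpha>)"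
proof -
  interpret prob_space M using BM by (simp add: brownian_motion_def)
  have \<beta>: "0 < \<beta>" "1 + q * \<alpha> < q * \<beta>"
  proof -
    have "q * \<alpha> < q * (\<beta> - 1 / q)" using \<alpha>(2) q by (intro mult_strict_left_mono) auto
    then show "1 + q * \<alpha> < q * \<beta>" using q by (simp add: right_diff_distrib)
    have "0 < 1 / q" using q by simp
    with \<alpha> show "0 < \<beta>" by linarith
  qed
  let ?R = "\<lambda>s t \<omega>. remainder (\<lambda>u. B u \<omega>) (\<lambda>u. I u \<omega>) (\<lambda>u. Q u \<omega>) s t"
  let ?p = "dyadic_point r T" and ?b = "dyadic_below r T"
  note p_in = dyadic_point_in[OF r(2)] and b_in = dyadic_below_in[OF r(2)]
  have B: "strongly_measurable M (B t)" if "t \<in> {r..T}" for t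
    using brownian_motion_strongly_measurable[OF BM] r(1) that by auto
  have R: "strongly_measurable M (?R s t)" if "s \<in> {r..T}" "t \<in> {r..T}" for s t
    using that by (intro strongly_measurable_remainder B Q I)
  obtain CB where CB: "CB \<ge> 0" "\<And>s t. 0 \<le> s \<Longrightarrow> 0 \<le> t \<Longrightarrow>
       (\<integral>\<^sup>+ \<omega>. ennreal (norm (B t \<omega> - B s \<omega>) powr q) \<partial>M) \<le> ennreal (CB * \<bar>t - s\<bar> powr (q / 2))"
    using brownian_increment_moment[OF BM, of q] q by auto

  \<comment> \<open>one random variable \<open>A\<close> controls all increments over neighbouring dyadic points\<close>
  define X where "X n i \<omega> = ennreal (norm (Q (?p n (Suc i)) \<omega> - Q (?p n i) \<omega>) powr q)
      + ennreal (norm (B (?p n (Suc i)) \<omega> - B (?p n i) \<omega>) powr q)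
      + ennreal (norm (?R (?p n i) (?p n (Suc i)) \<omega>) powr (q / 2))" for n i \<omega>
  define A where "A \<omega> = (\<Sum>n. \<Sum>i<2 ^ n. ennreal ((2 powr (q * \<alpha>)) ^ n) * X n i \<omega>)" for \<omega>
  have X_parts [measurable]:
    "(\<lambda>\<omega>. norm (Q (?p n (Suc i)) \<omega> - Q (?p n i) \<omega>)) \<in> borel_measurable M"
    "(\<lambda>\<omega>. norm (B (?p n (Suc i)) \<omega> - B (?p n i) \<omega>)) \<in> borel_measurable M"
    "(\<lambda>\<omega>. norm (?R (?p n i) (?p n (Suc i)) \<omega>)) \<in> borel_measurable M" if "i < 2 ^ n" for n i
    using that by (auto intro!: borel_measurable_norm_of_strongly_measurable strongly_measurable_diff Q B R p_in)
  have X_meas: "X n i \<in> borel_measurable M" if "i < 2 ^ n" for n i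
    unfolding X_def using X_parts[OF that] by measurable
  have A_meas [measurable]: "A \<in> borel_measurable M"
    unfolding A_def
    by (intro borel_measurable_suminf_order borel_measurable_sum borel_measurable_times_ennreal
        borel_measurable_const X_meas) auto
  have A_finite: "(\<integral>\<^sup>+\<omega>. A \<omega> \<partial>M) < \<infinity>"
    unfolding A_def
  proof (rule nn_integral_dyadic_sum_finite[OF X_meas _ \<beta>(2)])
    let ?D = "2 * (C * (T - r) powr (q * \<beta>)) + CB * (T - r) powr (q / 2)"
    show "0 \<le> ?D" using \<open>C > 0\<close> CB by simp
    fix n i :: nat assume i: "i < 2 ^ n"
    then have pts: "?p n i \<in> {r..T}" "?p n (Suc i) \<in> {r..T}" by (simp_all add: p_in del: atLeastAtMost_iff)
    have d: "\<bar>?p n (Suc i) - ?p n i\<bar> = (T - r) / 2 ^ n"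
      unfolding dyadic_point_diff using r(2) by simp
    let ?g = "2 powr - (q * \<beta>)"
    have "(\<integral>\<^sup>+\<omega>. X n i \<omega> \<partial>M)
      = (\<integral>\<^sup>+\<omega>. ennreal (norm (Q (?p n (Suc i)) \<omega> - Q (?p n i) \<omega>) powr q) \<partial>M)
      + (\<integral>\<^sup>+\<omega>. ennreal (norm (B (?p n (Suc i)) \<omega> - B (?p n i) \<omega>) powr q) \<partial>M)
      + (\<integral>\<^sup>+\<omega>. ennreal (norm (?R (?p n i) (?p n (Suc i)) \<omega>) powr (q / 2)) \<partial>M)"
      unfolding X_def using X_parts[OF i] by (simp add: nn_integral_add)
    also have "\<dots> \<le> ennreal (C * (T - r) powr (q * \<beta>) * ?g ^ n)
      + ennreal (CB * (T - r) powr (q / 2) * ?g ^ n) + ennreal (C * (T - r) powr (q * \<beta>) * ?g ^ n)"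
    proof (intro add_mono)
      show "(\<integral>\<^sup>+\<omega>. ennreal (norm (Q (?p n (Suc i)) \<omega> - Q (?p n i) \<omega>) powr q) \<partial>M)
          \<le> ennreal (C * (T - r) powr (q * \<beta>) * ?g ^ n)"
        using Q_moment[OF pts] r(2) by (simp add: d powr_dyadic_scale mult.assoc)
      show "(\<integral>\<^sup>+\<omega>. ennreal (norm (?R (?p n i) (?p n (Suc i)) \<omega>) powr (q / 2)) \<partial>M)
          \<le> ennreal (C * (T - r) powr (q * \<beta>) * ?g ^ n)"
        using R_moment[OF pts] r(2) by (simp add: d powr_dyadic_scale mult.assoc)
      have "(\<integral>\<^sup>+\<omega>. ennreal (norm (B (?p n (Suc i)) \<omega> - B (?p n i) \<omega>) powr q) \<partial>M)
          \<le> ennreal (CB * (T - r) powr (q / 2) * (2 powr - (q / 2)) ^ n)"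
        using CB(2)[of "?p n i" "?p n (Suc i)"] pts r by (simp add: d powr_dyadic_scale mult.assoc)
      also have "\<dots> \<le> ennreal (CB * (T - r) powr (q / 2) * ?g ^ n)"
        \<comment> \<open>the Brownian rate \<open>q / 2\<close> is at least \<open>q * \<beta>\<close>\<close>
        using CB(1) q mult_left_mono[OF \<open>\<beta> \<le> 1 / 2\<close>, of q]
        by (intro ennreal_leI mult_left_mono power_mono powr_mono) auto
      finally show "(\<integral>\<^sup>+\<omega>. ennreal (norm (B (?p n (Suc i)) \<omega> - B (?p n i) \<omega>) powr q) \<partial>M)
          \<le> ennreal (CB * (T - r) powr (q / 2) * ?g ^ n)" .
    qed
    also have "\<dots> = ennreal (?D * ?g ^ n)"
      using \<open>C > 0\<close> CB by (simp add: ennreal_plus[symmetric] algebra_simps del: ennreal_plus)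
    finally show "(\<integral>\<^sup>+\<omega>. X n i \<omega> \<partial>M) \<le> ennreal (?D * ?g ^ n)" .
  qed
  define K where "K \<omega> = enn2real (A \<omega>) powr (1 / q)" for \<omega>
  have K_nonneg: "0 \<le> K \<omega>" for \<omega> by (simp add: K_def)
  have K_bounds:
    "norm (Q (?p n (Suc i)) \<omega> - Q (?p n i) \<omega>) \<le> K \<omega> * (2 powr -\<alpha>) ^ n"
    "norm (B (?p n (Suc i)) \<omega> - B (?p n i) \<omega>) \<le> K \<omega> * (2 powr -\<alpha>) ^ n"
    "norm (?R (?p n i) (?p n (Suc i)) \<omega>) \<le> (K \<omega> * (2 powr -\<alpha>) ^ n)\<^sup>2"
    if "A \<omega> < \<infinity>" "i < 2 ^ n" for \<omega> n i
  proof -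
    let ?w = "(2 powr (q * \<alpha>)) ^ n"
    have "ennreal ?w * X n i \<omega> \<le> (\<Sum>i<2 ^ n. ennreal ?w * X n i \<omega>)"
      using \<open>i < 2 ^ n\<close> by (intro member_le_sum) auto
    also have "\<dots> \<le> A \<omega>"
      unfolding A_def using sum_le_suminf[of "\<lambda>n. \<Sum>i<2 ^ n. ennreal ((2 powr (q * \<alpha>)) ^ n) * X n i \<omega>" "{n}"]
      by auto
    finally have "ennreal ?w * X n i \<omega> \<le> ennreal (enn2real (A \<omega>))" using \<open>A \<omega> < \<infinity>\<close> by simp
    then have part: "?w * u \<le> enn2real (A \<omega>)" if "ennreal u \<le> X n i \<omega>" "0 \<le> u" for u
    proof -
      have "ennreal (?w * u) \<le> ennreal ?w * X n i \<omega>"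
        using that by (simp add: ennreal_mult mult_left_mono)
      also note \<open>ennreal ?w * X n i \<omega> \<le> ennreal (enn2real (A \<omega>))\<close>
      finally show ?thesis by (subst (asm) ennreal_le_iff) simp_all
    qed
    show "norm (Q (?p n (Suc i)) \<omega> - Q (?p n i) \<omega>) \<le> K \<omega> * (2 powr -\<alpha>) ^ n"
      unfolding K_def using q
      by (intro le_root_of_weighted_power_le part) (auto simp: X_def add_increasing2)
    show "norm (B (?p n (Suc i)) \<omega> - B (?p n i) \<omega>) \<le> K \<omega> * (2 powr -\<alpha>) ^ n"
      unfolding K_def using q
      by (intro le_root_of_weighted_power_le part) (auto simp: X_def add_increasing add_increasing2)
    have "norm (?R (?p n i) (?p n (Suc i)) \<omega>) \<le> enn2real (A \<omega>) powr (1 / (q / 2)) * (2 powr - (2 * \<alpha>)) ^ n"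
    proof (rule le_root_of_weighted_power_le)
      have "?w * norm (?R (?p n i) (?p n (Suc i)) \<omega>) powr (q / 2) \<le> enn2real (A \<omega>)"
        by (rule part) (auto simp: X_def add_increasing)
      then show "(2 powr (q / 2 * (2 * \<alpha>))) ^ n * norm (?R (?p n i) (?p n (Suc i)) \<omega>) powr (q / 2)
          \<le> enn2real (A \<omega>)" by simp
    qed (use q in auto)
    also have "\<dots> = (K \<omega> * (2 powr -\<alpha>) ^ n)\<^sup>2"
    proof -
      have "enn2real (A \<omega>) powr (1 / (q / 2)) = K \<omega> * K \<omega>"
        by (simp add: K_def powr_add[symmetric])
      moreover have "2 powr - (2 * \<alpha>) = 2 powr -\<alpha> * 2 powr -\<alpha>" by (simp add: powr_add[symmetric])
      ultimately show ?thesis by (simp add: power_mult_distrib power2_eq_square)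
    qed
    finally show "norm (?R (?p n i) (?p n (Suc i)) \<omega>) \<le> (K \<omega> * (2 powr -\<alpha>) ^ n)\<^sup>2" .
  qed

  \<comment> \<open>Discontinuity of the Brownian path need not be a measurable event; it is only contained in
    a null set.\<close>
  obtain N where N: "{\<omega> \<in> space M. \<not> continuous_on {0..} (\<lambda>t. B t \<omega>)} \<subseteq> N" "N \<in> null_sets M"
    using BM unfolding brownian_motion_def eventually_ae_filter by blast
  define G where "G = {\<omega> \<in> space M. A \<omega> < \<infinity>} - N"
  have G [measurable]: "G \<in> sets M" unfolding G_def using N(2) by auto
  have AE_G: "AE \<omega> in M. \<omega> \<in> G"
  proof -
    have "AE \<omega> in M. A \<omega> \<noteq> \<infinity>" using A_finite by (intro nn_integral_PInf_AE) auto
    moreover have "AE \<omega> in M. \<omega> \<notin> N" using N(2) by (rule AE_not_in)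
    ultimately show ?thesis by (auto simp: G_def less_top)
  qed
  have G_finite: "A \<omega> < \<infinity>" if "\<omega> \<in> G" for \<omega> using that by (simp add: G_def)
  have B_lim: "(\<lambda>n. B (?b n t) \<omega>) \<longlonglongrightarrow> B t \<omega>" if "\<omega> \<in> G" "t \<in> {r..T}" for \<omega> t
  proof -
    have "continuous_on {0..} (\<lambda>t. B t \<omega>)" using N(1) that by (auto simp: G_def)
    then have "continuous_on {r..T} (\<lambda>t. B t \<omega>)" by (rule continuous_on_subset) (use r in auto)
    then show ?thesis
      by (rule continuous_on_tendsto_compose[OF _ dyadic_below_tendsto[OF r(2)]])
         (use that b_in in \<open>auto intro!: always_eventually\<close>)
  qed
  define Q' where "Q' t \<omega> = lim (\<lambda>n. indicat_real G \<omega> *\<^sub>R Q (?b n t) \<omega>)" for t \<omega>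
  define I' where "I' t \<omega> = lim (\<lambda>n. indicat_real G \<omega> *\<^sub>R I (?b n t) \<omega>)" for t \<omega>
  have G_lim: "(\<lambda>n. Q (?b n t) \<omega>) \<longlonglongrightarrow> Q' t \<omega>" "(\<lambda>n. I (?b n t) \<omega>) \<longlonglongrightarrow> I' t \<omega>"
    if "\<omega> \<in> G" "t \<in> {r..T}" for \<omega> t
    using dyadic_limits_convergent[OF r(2) _ _ K_nonneg[of \<omega>], of "2 powr -\<alpha>"
        "\<lambda>u. B u \<omega>" "\<lambda>u. Q u \<omega>" "\<lambda>u. I u \<omega>" t]
      powr_ratio_bounds[OF \<alpha>(1)] K_bounds[OF G_finite[OF that(1)]] that
    by (simp_all add: Q'_def I'_def convergent_LIMSEQ_iff)
  have outside: "Q' t \<omega> = 0" "I' t \<omega> = 0" if "\<omega> \<notin> G" for t \<omega>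
    using that by (simp_all add: Q'_def I'_def)
  have Q'_meas: "strongly_measurable M (Q' t)" if "t \<in> {r..T}" for t
  proof (rule strongly_measurable_LIMSEQ)
    show "strongly_measurable M (\<lambda>\<omega>. indicat_real G \<omega> *\<^sub>R Q (?b n t) \<omega>)" for n
      using that by (intro strongly_measurable_restrict Q b_in G)
    show "(\<lambda>n. indicat_real G \<omega> *\<^sub>R Q (?b n t) \<omega>) \<longlonglongrightarrow> Q' t \<omega>" for \<omega>
      using G_lim(1)[of \<omega> t] that outside(1)[of \<omega> t] by (cases "\<omega> \<in> G") simp_all
  qed
  have I'_meas: "strongly_measurable M (I' t)" if "t \<in> {r..T}" for t
  proof (rule strongly_measurable_LIMSEQ)
    show "strongly_measurable M (\<lambda>\<omega>. indicat_real G \<omega> *\<^sub>R I (?b n t) \<omega>)" for n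
      using that by (intro strongly_measurable_restrict I b_in G)
    show "(\<lambda>n. indicat_real G \<omega> *\<^sub>R I (?b n t) \<omega>) \<longlonglongrightarrow> I' t \<omega>" for \<omega>
      using G_lim(2)[of \<omega> t] that outside(2)[of \<omega> t] by (cases "\<omega> \<in> G") simp_all
  qed

  \<comment> \<open>The moment bounds are summable along the approximations of a fixed time, so that the
    dyadic limits are versions of \<open>Q\<close> and \<open>I\<close>.\<close>
  have ratio: "0 \<le> 2 powr -(q * \<beta>)" "2 powr -(q * \<beta>) < (1::real)" "0 \<le> C * (T - r) powr (q * \<beta>)"
    using powr_ratio_bounds[of "q * \<beta>"] q \<beta>(1) \<open>C > 0\<close> by auto
  have scale: "ennreal (C * \<bar>t - ?b n t\<bar> powr (q * \<beta>))
      \<le> ennreal (C * (T - r) powr (q * \<beta>) * (2 powr -(q * \<beta>)) ^ n)" if "t \<in> {r..T}" for n t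
  proof -
    have "\<bar>t - ?b n t\<bar> powr (q * \<beta>) \<le> ((T - r) / 2 ^ n) powr (q * \<beta>)"
      using dyadic_below_bounds[OF r(2) that, of n] q \<beta>(1) by (intro powr_mono2) auto
    then show ?thesis
      using \<open>C > 0\<close> r(2) by (simp add: powr_dyadic_scale mult.assoc ennreal_leI)
  qed
  have Q'_AE: "AE \<omega> in M. Q' t \<omega> = Q t \<omega>" if t: "t \<in> {r..T}" for t
  proof -
    have "AE \<omega> in M. (\<lambda>n. norm (Q t \<omega> - Q (?b n t) \<omega>)) \<longlonglongrightarrow> 0"
      using q t ratio order_trans[OF Q_moment[OF b_in[OF t] t] scale[OF t]]
      by (intro AE_tendsto_zero_of_geometric_moments[where p = q and \<rho> = "2 powr -(q * \<beta>)"
            and D = "C * (T - r) powr (q * \<beta>)"])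
         (auto intro!: borel_measurable_norm_of_strongly_measurable strongly_measurable_diff Q b_in)
    with AE_G show ?thesis
    proof eventually_elim
      case (elim \<omega>)
      then have "(\<lambda>n. Q t \<omega> - (Q t \<omega> - Q (?b n t) \<omega>)) \<longlonglongrightarrow> Q t \<omega> - 0"
        by (intro tendsto_diff tendsto_const) (simp only: tendsto_norm_zero_iff)
      then have "(\<lambda>n. Q (?b n t) \<omega>) \<longlonglongrightarrow> Q t \<omega>" by simp
      with G_lim(1)[OF elim(1) t] show ?case by (rule LIMSEQ_unique)
    qed
  qed
  have I'_AE: "AE \<omega> in M. I' t \<omega> = I t \<omega>" if t: "t \<in> {r..T}" for t
  proof -
    have "AE \<omega> in M. (\<lambda>n. norm (?R (?b n t) t \<omega>)) \<longlonglongrightarrow> 0"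
      using q t ratio order_trans[OF R_moment[OF b_in[OF t] t] scale[OF t]]
      by (intro AE_tendsto_zero_of_geometric_moments[where p = "q / 2" and \<rho> = "2 powr -(q * \<beta>)"
            and D = "C * (T - r) powr (q * \<beta>)"])
         (auto intro!: borel_measurable_norm_of_strongly_measurable R b_in)
    with AE_G show ?thesis
    proof eventually_elim
      case (elim \<omega>)
      have "(\<lambda>n. I t \<omega> - ?R (?b n t) t \<omega> - blinfun_apply (Q (?b n t) \<omega>) (B t \<omega> - B (?b n t) \<omega>))
          \<longlonglongrightarrow> I t \<omega> - 0 - blinfun_apply (Q' t \<omega>) (B t \<omega> - B t \<omega>)"
        using elim(2) by (intro tendsto_intros G_lim(1) B_lim elim(1) t) (simp only: tendsto_norm_zero_iff)
      then have "(\<lambda>n. I (?b n t) \<omega>) \<longlonglongrightarrow> I t \<omega>" by (simp add: remainder_def)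
      with G_lim(2)[OF elim(1) t] show ?case by (rule LIMSEQ_unique)
    qed
  qed

  define H where "H = chain_holder_const r T \<alpha>"
  define D where "D = chain_holder_rem_const r T \<alpha>"
  have HD: "0 \<le> H" "0 \<le> D"
    using \<alpha>(1) by (simp_all add: H_def D_def chain_holder_const_nonneg chain_holder_rem_const_nonneg)
  have Q'_holder: "norm (Q' t \<omega> - Q' s \<omega>) \<le> H * K \<omega> * \<bar>t - s\<bar> powr \<alpha>"
    if "\<omega> \<in> G" "s \<in> {r..T}" "t \<in> {r..T}" for s t \<omega>
    unfolding H_def using that(2,3) K_bounds(1)[OF G_finite[OF that(1)]] G_lim(1)[OF that(1)]
    by (intro increment_limit_holder[OF r(2) \<alpha>(1) K_nonneg, where f = "\<lambda>u. Q u \<omega>" and g = "\<lambda>u. Q' u \<omega>"])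
  have B_holder: "norm (B t \<omega> - B s \<omega>) \<le> H * K \<omega> * \<bar>t - s\<bar> powr \<alpha>"
    if "\<omega> \<in> G" "s \<in> {r..T}" "t \<in> {r..T}" for s t \<omega>
    unfolding H_def using that(2,3) K_bounds(2)[OF G_finite[OF that(1)]] B_lim[OF that(1)]
    by (intro increment_limit_holder[OF r(2) \<alpha>(1) K_nonneg, where f = "\<lambda>u. B u \<omega>" and g = "\<lambda>u. B u \<omega>"])
  have R'_holder: "norm (remainder (\<lambda>u. B u \<omega>) (\<lambda>u. I' u \<omega>) (\<lambda>u. Q' u \<omega>) s t)
      \<le> D * (K \<omega>)\<^sup>2 * \<bar>t - s\<bar> powr (2 * \<alpha>)"
    if "\<omega> \<in> G" "s \<in> {r..T}" "t \<in> {r..T}" for s t \<omega>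
    unfolding D_def
    using that(2,3) K_bounds[OF G_finite[OF that(1)]] B_lim[OF that(1)] G_lim[OF that(1)]
    by (intro remainder_limit_holder[OF r(2) \<alpha>(1) K_nonneg, where x = "\<lambda>u. I u \<omega>" and x' = "\<lambda>u. Q u \<omega>"])

  define k where "k \<omega> = D * (K \<omega>)\<^sup>2 + 1" for \<omega>
  show thesis
  proof (rule that[of Q' I' k])
    show "is_version M {r..T} Q Q'" "is_version M {r..T} I I'"
      unfolding is_version_def using Q'_meas Q'_AE I'_meas I'_AE by blast+
    show "k \<in> borel_measurable M" unfolding k_def K_def by measurable
    show "0 < k \<omega>" for \<omega>
      using HD(2) by (simp add: k_def add_nonneg_pos)
    have "(\<integral>\<^sup>+ \<omega>. ennreal (k \<omega> powr (q / 2)) \<partial>M)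
        \<le> (\<integral>\<^sup>+ \<omega>. ennreal (2 powr (q / 2)) * (ennreal (D powr (q / 2)) * A \<omega> + 1) \<partial>M)"
    proof (intro nn_integral_mono)
      fix \<omega>
      have "(D * (K \<omega>)\<^sup>2) powr (q / 2) = D powr (q / 2) * enn2real (A \<omega>)"
      proof -
        have "((K \<omega>)\<^sup>2) powr (q / 2) = (enn2real (A \<omega>) powr (2 / q)) powr (q / 2)"
          by (simp add: K_def power2_eq_square powr_add[symmetric])
        also have "\<dots> = enn2real (A \<omega>)" using q by (simp add: powr_powr)
        finally show ?thesis using HD(2) by (simp add: powr_mult)
      qed
      then have "k \<omega> powr (q / 2) \<le> 2 powr (q / 2) * (D powr (q / 2) * enn2real (A \<omega>) + 1)"
        using add_one_powr_le[of "D * (K \<omega>)\<^sup>2" "q / 2"] HD(2) q by (simp add: k_def)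
      then have "ennreal (k \<omega> powr (q / 2))
          \<le> ennreal (2 powr (q / 2)) * (ennreal (D powr (q / 2)) * ennreal (enn2real (A \<omega>)) + 1)"
        by (simp add: ennreal_mult[symmetric] ennreal_plus[symmetric] ennreal_leI del: ennreal_plus flip: ennreal_1)
      also have "\<dots> \<le> ennreal (2 powr (q / 2)) * (ennreal (D powr (q / 2)) * A \<omega> + 1)"
        by (intro mult_left_mono add_mono) (auto simp: ennreal_enn2real_if)
      finally show "ennreal (k \<omega> powr (q / 2)) \<le> ennreal (2 powr (q / 2)) * (ennreal (D powr (q / 2)) * A \<omega> + 1)" .
    qed
    also have "\<dots> = ennreal (2 powr (q / 2)) * (ennreal (D powr (q / 2)) * (\<integral>\<^sup>+\<omega>. A \<omega> \<partial>M) + 1)"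
      by (simp add: nn_integral_cmult nn_integral_add emeasure_space_1)
    also have "\<dots> < \<infinity>" using A_finite by (simp add: ennreal_mult_less_top)
    finally show "(\<integral>\<^sup>+ \<omega>. ennreal (k \<omega> powr (q / 2)) \<partial>M) < \<infinity>" .
    show "holder_on \<alpha> {r..T} (\<lambda>t. Q' t \<omega>)" for \<omega>
    proof (cases "\<omega> \<in> G")
      case True
      then show ?thesis using Q'_holder unfolding holder_on_def by blast
    qed (auto simp: outside holder_on_def intro!: exI[of _ 0])
    show "holder_on \<alpha> {r..T} (\<lambda>t. I' t \<omega>)" for \<omega>
    proof (cases "\<omega> \<in> G")
      case True
      show ?thesis
        by (rule holder_on_of_remainder_bound[OF r(2) \<alpha>(1) _ B_holder[OF True] Q'_holder[OF True]
              R'_holder[OF True]]) (use HD K_nonneg[of \<omega>] in auto)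
    qed (auto simp: outside holder_on_def intro!: exI[of _ 0])
    show "AE \<omega> in M. \<forall>s\<in>{r..T}. \<forall>t\<in>{r..T}.
       norm (remainder (\<lambda>u. B u \<omega>) (\<lambda>u. I' u \<omega>) (\<lambda>u. Q' u \<omega>) s t) \<le> k \<omega> * \<bar>t - s\<bar> powr (2 * \<alpha>)"
      using AE_G
    proof eventually_elim
      case (elim \<omega>)
      show ?case
      proof (intro ballI)
        fix s t assume "s \<in> {r..T}" "t \<in> {r..T}"
        from R'_holder[OF elim this]
        show "norm (remainder (\<lambda>u. B u \<omega>) (\<lambda>u. I' u \<omega>) (\<lambda>u. Q' u \<omega>) s t) \<le> k \<omega> * \<bar>t - s\<bar> powr (2 * \<alpha>)"
          by (rule order_trans) (simp add: k_def mult_right_mono)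
      qed
    qed
  qed
qed

section \<open>The remainder bound and the controlled versions\<close>

theorem proposition4p1:
  fixes M :: "'w measure" and F :: "real \<Rightarrow> 'w measure"
    and B :: "real \<Rightarrow> 'w \<Rightarrow> real ^ 'd"
    and Q :: "real \<Rightarrow> 'w \<Rightarrow> (real ^ 'd) \<Rightarrow>\<^sub>L 'e::banach"
    and I :: "real \<Rightarrow> 'w \<Rightarrow> 'e"
    and R :: "real \<Rightarrow> real \<Rightarrow> 'w \<Rightarrow> 'e"
    and r T q \<beta> C :: real
  assumes "brownian_motion M F B"
    and "0 < r" and "r < T"
    and "\<And>t. t \<in> {r..T} \<Longrightarrow> strongly_measurable M (Q t)"
    and "\<And>t. t \<in> {r..T} \<Longrightarrow> is_ito_integral M F B r t Q (I t)"
    and "\<And>s t \<omega>. R s t \<omega> = remainder (\<lambda>u. B u \<omega>) (\<lambda>u. I u \<omega>) (\<lambda>u. Q u \<omega>) s t"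
    and "q > 2" and "1 / q < \<beta>" and "\<beta> \<le> 1 / 2" and "C > 0"
    and "\<And>s t. s \<in> {r..T} \<Longrightarrow> t \<in> {r..T} \<Longrightarrow>
           (\<integral>\<^sup>+ \<omega>. ennreal (norm (Q t \<omega> - Q s \<omega>) powr q) \<partial>M) \<le> ennreal (C * \<bar>t - s\<bar> powr (q * \<beta>))"
    and "\<And>s t. s \<in> {r..T} \<Longrightarrow> t \<in> {r..T} \<Longrightarrow>
           (\<integral>\<^sup>+ \<omega>. ennreal (norm (R s t \<omega>) powr (q / 2)) \<partial>M) \<le> ennreal (C * \<bar>t - s\<bar> powr (q * \<beta>))"
  shows "(\<forall>\<alpha>. 0 < \<alpha> \<and> \<alpha> < \<beta> - 1 / q \<longrightarrow>
            (\<exists>R' k. is_version M ({r..T} \<times> {r..T}) (\<lambda>(s, t). R s t) (\<lambda>(s, t). R' s t) \<and>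
               k \<in> borel_measurable M \<and> (\<forall>\<omega>\<in>space M. 0 < k \<omega>) \<and>
               (\<integral>\<^sup>+ \<omega>. ennreal (\<bar>k \<omega>\<bar> powr (q / 2)) \<partial>M) < \<infinity> \<and>
               (AE \<omega> in M. \<forall>s\<in>{r..T}. \<forall>t\<in>{r..T}. norm (R' s t \<omega>) \<le> k \<omega> * \<bar>t - s\<bar> powr (2 * \<alpha>)))) \<and>
         (\<beta> - 1 / q > 1 / 3 \<longrightarrow>
            (\<forall>\<alpha>. 1 / 3 < \<alpha> \<and> \<alpha> < \<beta> - 1 / q \<longrightarrow>
               (\<exists>Q' I'. is_version M {r..T} Q Q' \<and> is_version M {r..T} I I' \<and>
                  (\<forall>\<omega>\<in>space M. holder_on \<alpha> {r..T} (\<lambda>t. Q' t \<omega>) \<and> holder_on \<alpha> {r..T} (\<lambda>t. I' t \<omega>)) \<and>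
                  (AE \<omega> in M. controlled_by \<alpha> {r..T} (\<lambda>t. B t \<omega>) (\<lambda>t. I' t \<omega>) (\<lambda>t. Q' t \<omega>)))))"
proof -
  have I: "strongly_measurable M (I t)" if "t \<in> {r..T}" for t
    using assms(5)[OF that] by (simp add: is_ito_integral_def)
  have R_eq: "R s t = (\<lambda>\<omega>. remainder (\<lambda>u. B u \<omega>) (\<lambda>u. I u \<omega>) (\<lambda>u. Q u \<omega>) s t)" for s t
    using assms(6) by blast
  note versions = controlled_versions_exist[OF assms(1-4) I assms(7,9,10,11) assms(12)[unfolded R_eq]]
  show ?thesis
  proof (intro conjI impI allI)
    fix \<alpha> assume "0 < \<alpha> \<and> \<alpha> < \<beta> - 1 / q"
    then have \<alpha>: "0 < \<alpha>" "\<alpha> < \<beta> - 1 / q" by auto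
    obtain Q' I' k where Q': "is_version M {r..T} Q Q'" and I': "is_version M {r..T} I I'"
      and k: "k \<in> borel_measurable M" "\<And>\<omega>. \<omega> \<in> space M \<Longrightarrow> 0 < k \<omega>"
        "(\<integral>\<^sup>+ \<omega>. ennreal (k \<omega> powr (q / 2)) \<partial>M) < \<infinity>"
      and bound: "AE \<omega> in M. \<forall>s\<in>{r..T}. \<forall>t\<in>{r..T}.
        norm (remainder (\<lambda>u. B u \<omega>) (\<lambda>u. I' u \<omega>) (\<lambda>u. Q' u \<omega>) s t) \<le> k \<omega> * \<bar>t - s\<bar> powr (2 * \<alpha>)"
      by (rule versions[OF _ _ _ _ _ _ \<alpha>]) blast+
    define R' where "R' s t \<omega> = remainder (\<lambda>u. B u \<omega>) (\<lambda>u. I' u \<omega>) (\<lambda>u. Q' u \<omega>) s t" for s t \<omega>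
    have B: "strongly_measurable M (B t)" if "t \<in> {r..T}" for t
      using brownian_motion_strongly_measurable[OF assms(1)] assms(2) that by auto
    have "is_version M ({r..T} \<times> {r..T}) (\<lambda>(s, t). R s t) (\<lambda>(s, t). R' s t)"
      unfolding is_version_def
    proof clarify
      fix s t assume st: "s \<in> {r..T}" "t \<in> {r..T}"
      have "strongly_measurable M (R' s t)"
        unfolding R'_def using Q' I' st
        by (intro strongly_measurable_remainder B) (auto simp: is_version_def)
      moreover have "AE \<omega> in M. Q' s \<omega> = Q s \<omega>" "AE \<omega> in M. I' s \<omega> = I s \<omega>" "AE \<omega> in M. I' t \<omega> = I t \<omega>"
        using Q' I' st by (auto simp: is_version_def)
      then have "AE \<omega> in M. R' s t \<omega> = R s t \<omega>"
        by eventually_elim (simp add: R'_def R_eq remainder_def)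
      ultimately show "strongly_measurable M (R' s t) \<and> (AE \<omega> in M. R' s t \<omega> = R s t \<omega>)" ..
    qed
    moreover have "(\<integral>\<^sup>+ \<omega>. ennreal (\<bar>k \<omega>\<bar> powr (q / 2)) \<partial>M) < \<infinity>"
    proof -
      have "(\<integral>\<^sup>+ \<omega>. ennreal (\<bar>k \<omega>\<bar> powr (q / 2)) \<partial>M) = (\<integral>\<^sup>+ \<omega>. ennreal (k \<omega> powr (q / 2)) \<partial>M)"
        using k(2) by (intro nn_integral_cong) (simp add: abs_of_pos)
      with k(3) show ?thesis by simp
    qed
    ultimately show "\<exists>R' k. is_version M ({r..T} \<times> {r..T}) (\<lambda>(s, t). R s t) (\<lambda>(s, t). R' s t) \<and>
         k \<in> borel_measurable M \<and> (\<forall>\<omega>\<in>space M. 0 < k \<omega>) \<and>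
         (\<integral>\<^sup>+ \<omega>. ennreal (\<bar>k \<omega>\<bar> powr (q / 2)) \<partial>M) < \<infinity> \<and>
         (AE \<omega> in M. \<forall>s\<in>{r..T}. \<forall>t\<in>{r..T}. norm (R' s t \<omega>) \<le> k \<omega> * \<bar>t - s\<bar> powr (2 * \<alpha>))"
      using k(1,2) bound unfolding R'_def[symmetric] by blast
  next
    fix \<alpha> assume "1 / 3 < \<alpha> \<and> \<alpha> < \<beta> - 1 / q"
    then have \<alpha>: "0 < \<alpha>" "\<alpha> < \<beta> - 1 / q" by auto
    obtain Q' I' k where Q': "is_version M {r..T} Q Q'" and I': "is_version M {r..T} I I'"
      and holder: "\<And>\<omega>. \<omega> \<in> space M \<Longrightarrow> holder_on \<alpha> {r..T} (\<lambda>t. Q' t \<omega>)"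
        "\<And>\<omega>. \<omega> \<in> space M \<Longrightarrow> holder_on \<alpha> {r..T} (\<lambda>t. I' t \<omega>)"
      and bound: "AE \<omega> in M. \<forall>s\<in>{r..T}. \<forall>t\<in>{r..T}.
        norm (remainder (\<lambda>u. B u \<omega>) (\<lambda>u. I' u \<omega>) (\<lambda>u. Q' u \<omega>) s t) \<le> k \<omega> * \<bar>t - s\<bar> powr (2 * \<alpha>)"
      by (rule versions[OF _ _ _ _ _ _ \<alpha>]) blast+
    have "AE \<omega> in M. controlled_by \<alpha> {r..T} (\<lambda>t. B t \<omega>) (\<lambda>t. I' t \<omega>) (\<lambda>t. Q' t \<omega>)"
      using bound AE_space
    proof eventually_elim
      case (elim \<omega>)
      then have "norm (remainder (\<lambda>t. B t \<omega>) (\<lambda>t. I' t \<omega>) (\<lambda>t. Q' t \<omega>) s t) / \<bar>t - s\<bar> powr (2 * \<alpha>) \<le> k \<omega>"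
        if "s \<in> {r..T}" "t \<in> {r..T}" "s \<noteq> t" for s t
        using that by (simp add: pos_divide_le_eq)
      then have "bdd_above {norm (remainder (\<lambda>t. B t \<omega>) (\<lambda>t. I' t \<omega>) (\<lambda>t. Q' t \<omega>) s t) / \<bar>t - s\<bar> powr (2 * \<alpha>)
          | s t. s \<in> {r..T} \<and> t \<in> {r..T} \<and> s \<noteq> t}"
        by (intro bdd_aboveI[of _ "k \<omega>"]) blast
      with holder elim(2) show ?case by (simp add: controlled_by_def)
    qed
    with Q' I' holder show "\<exists>Q' I'. is_version M {r..T} Q Q' \<and> is_version M {r..T} I I' \<and>
        (\<forall>\<omega>\<in>space M. holder_on \<alpha> {r..T} (\<lambda>t. Q' t \<omega>) \<and> holder_on \<alpha> {r..T} (\<lambda>t. I' t \<omega>)) \<and>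
        (AE \<omega> in M. controlled_by \<alpha> {r..T} (\<lambda>t. B t \<omega>) (\<lambda>t. I' t \<omega>) (\<lambda>t. Q' t \<omega>))"
      by blast
  qed
qed

end
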